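(* Consider the stochastic first-order method described in the context with proximal function $\phi(\mathbf z)=\frac{\hat\rho}{2}\|\mathbf z\|_1^2$, variance-reduced gradient estimates $G^k$ (with interval length $q_0$ and batch sizes $m_1,m$) as described in the context, constant stepsize $\eta_k\equiv\eta>0$, and $p_k=1/K$; suppose that the assumptions (i)–(iv) in the context hold and, with $\Omega=e^2\log d$ and $t=2\eta/\hat\rho$, that $\frac{\hat\rho}{4\eta}-\frac L2-\frac{2t\Omega^2L^2q_0}{m}>0$. Let $$\eta=\frac1L,\quad K=\left\lceil\frac{\Delta_fL}{\epsilon^2}\right\rceil,\quad m_1=\left\lceil\frac{\Omega e^2(\log d)\sigma_\infty^2}{\epsilon^2}\right\rceil,\quad m=q_0\Omega^2,\quad mq_0=m_1,\quad \hat\rho\ge6 .$$ Then $$\mathbb E\big[\mathrm{dist}_{\|\cdot\|_\infty}(0,\partial(f+\delta_X)(\mathbf x^{Y+1}))\big]\le C_3(\hat\rho)\,\epsilon,$$ where $C_3(\hat\rho)$ is a constant only dependent on $\hat\rho$. The sample complexity is upper bounded by $$Km+\left\lceil\frac{K}{q_0}\right\rceil m_1\le3Km=\mathcal O\left(\frac{\Delta_fL\,\Omega^2\sigma_\infty}{\epsilon^3}\right)=\mathcal O\left(\frac{\Delta_fL(\log d)^2\sigma_\infty}{\epsilon^3}\right).$$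
   Context: Problem: minimize $f(\mathbf x)=\mathbb E[F(\mathbf x,\zeta)]$ over $\mathbf x\in X$, where $X\subseteq\mathbb R^d$ is closed and convex, $\zeta$ is a random vector with values in $\Xi$, the expectation is well defined and finite for every $\mathbf x\in\mathbb R^d$, and $f$ is everywhere differentiable and possibly nonconvex. I.i.d. realizations of $\zeta$ can be generated. $F(\cdot,\zeta)$ is everywhere differentiable for all $\zeta\in\Xi$, and the stochastic gradient is $\nabla F(\mathbf x,\zeta)$, with $\mathbb E[\nabla F(\mathbf x,\zeta)]=\nabla f(\mathbf x)$ for all $\mathbf x\in X$. $\|\cdot\|$ is the Euclidean norm. Assumptions: (i) a stochastic first-order oracle is available, i.e. the stochastic gradient can be efficiently evaluated for any given $(\mathbf x,\zeta)$; (ii) $\sigma_\infty^2=\max_{\mathbf x\in X}\mathbb E[\|\nabla F(\mathbf x,\zeta)-\nabla f(\mathbf x)\|_\infty^2]<\infty$; (iii) for some constant $L\ge0$, $\mathbb E[\|\nabla F(\mathbf x,\zeta)-\nabla F(\mathbf y,\zeta)\|_\infty^2]\le L^2\|\mathbf x-\mathbf y\|_1^2$ for all $\mathbf x,\mathbf y\in X$; (iv) for some $\underline f\in\mathbb R$, $f(\mathbf x)\ge\underline f$ for all $\mathbf x\in X$. Set $\Delta_f=\mathbb E[f(\mathbf x^1)]-\underline f$. The number $\epsilon>0$ is the target accuracy. Algorithm: choose $\mathbf x^1\in X$, $K$, and stepsizes $\eta_k>0$. For $k=1,\dots,K$: generate the gradient estimate $G^k$ and set $$\mathbf x^{k+1}=\arg\min_{\mathbf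 x\in X}\left\{\tfrac12\|\mathbf x-(\mathbf x^k-\eta_kG^k)\|^2+\phi(\mathbf x-\mathbf x^k)\right\}.$$ Output $\mathbf x^{Y+1}$ for a randomly drawn index $Y$ (independent of the iterates) with $\mathbb P[Y=k]=p_k$, $k=1,\dots,K$. Variance-reduced estimate: given the interval length $q_0$, let $m_k=m_1$ if $k\equiv1\pmod{q_0}$ and $m_k=m$ otherwise; with $\zeta_i^k$ i.i.d. realizations of $\zeta$, independent of the algorithmic history, $$G^k=\begin{cases}\frac1{m_k}\sum_{i=1}^{m_k}\nabla F(\mathbf x^k,\zeta_i^k), & k\equiv1\pmod{q_0},\\ \frac1{m_k}\left(\sum_{i=1}^{m_k}\nabla F(\mathbf x^k,\zeta_i^k)-\sum_{i=1}^{m_k}\nabla F(\mathbf x^{k-1},\zeta_i^k)\right)+G^{k-1}, & \text{otherwise.}\end{cases}$$ The sample complexity is the total number of samples of $\zeta$ used. Notation: $\delta_X$ is the indicator function of $X$ ($0$ on $X$, $+\infty$ off $X$), $\partial$ is the Fréchet subdifferential, and $\mathrm{dist}_{\|\cdot\|_\infty}(0,S)=\inf\{\|\mathbf v\|_\infty:\mathbf v\in S\}$.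
   Formalization: The bounds ≤3Km=O(…) are proved only for ε ≤ min(σ_∞, Δ_f L/σ_∞), with explicit constants 18 and 18e^4, since they fail for large ε (e.g. K=1, q_0=4); m=q_0Ω² is read as m=⌈q_0Ω²⌉ because batch sizes are integers. *)

theory Defs
  imports "HOL-Probability.Probability"
begin

definition norm1 :: "real ^ 'n \<Rightarrow> real" where
  "norm1 x = (\<Sum>i\<in>UNIV. \<bar>x $ i\<bar>)"

definition grad :: "('a::real_inner \<Rightarrow> real) \<Rightarrow> 'a \<Rightarrow> 'a" where
  "grad f x = (THE g. GDERIV f x :> g)"

definition indicator_fun :: "'a set \<Rightarrow> 'a \<Rightarrow> ereal" where
  "indicator_fun X x = (if x \<in> X then 0 else \<infinity>)"

definition frechet_subdiff :: "('a::real_inner \<Rightarrow> ereal) \<Rightarrow> 'a \<Rightarrow> 'a set" where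
  "frechet_subdiff g x =
     {v. \<bar>g x\<bar> \<noteq> \<infinity> \<and>
         0 \<le> Liminf (at x) (\<lambda>y. (g y - g x - ereal (v \<bullet> (y - x))) / ereal (norm (y - x)))}"

text \<open>Extended-valued, so that the distance to the empty set is \<open>\<infinity>\<close>.\<close>
definition dist_inf_zero :: "'a::euclidean_space set \<Rightarrow> ennreal" where
  "dist_inf_zero S = (INF v\<in>S. ennreal (infnorm v))"

text \<open>Independence of two random variables whose value spaces may have different types
  (\<open>prob_space.indep_var\<close> forces the types to agree).\<close>
definition indep_rvs ::
  "'w measure \<Rightarrow> 'a measure \<Rightarrow> ('w \<Rightarrow> 'a) \<Rightarrow> 'b measure \<Rightarrow> ('w \<Rightarrow> 'b) \<Rightarrow> bool" where
  "indep_rvs M S U T V \<longleftrightarrow>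
     U \<in> measurable M S \<and> V \<in> measurable M T \<and>
     prob_space.indep_set M
       {U -` A \<inter> space M | A. A \<in> sets S} {V -` B \<inter> space M | B. B \<in> sets T}"

text \<open>The random element \<open>\<zeta>\<close> enters through its law \<open>D\<close>; its range \<open>\<Xi>\<close> is \<open>space D\<close>.\<close>

definition objective :: "'z measure \<Rightarrow> ('v \<Rightarrow> 'z \<Rightarrow> real) \<Rightarrow> 'v \<Rightarrow> real" where
  "objective D F x = (\<integral>z. F x z \<partial>D)"

definition stoch_grad :: "('v::real_inner \<Rightarrow> 'z \<Rightarrow> real) \<Rightarrow> 'v \<Rightarrow> 'z \<Rightarrow> 'v" where
  "stoch_grad F x z = grad (\<lambda>y. F y z) x"

text \<open>The maximum over \<open>X\<close> is read as a supremum, which need not be attained.\<close>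
definition noise_level ::
  "'z measure \<Rightarrow> (real ^ 'n \<Rightarrow> 'z \<Rightarrow> real) \<Rightarrow> (real ^ 'n) set \<Rightarrow> ennreal" where
  "noise_level D F X =
     (SUP x\<in>X. \<integral>\<^sup>+z. ennreal ((infnorm (stoch_grad F x z - grad (objective D F) x))\<^sup>2) \<partial>D)"

definition sigma_inf ::
  "'z measure \<Rightarrow> (real ^ 'n \<Rightarrow> 'z \<Rightarrow> real) \<Rightarrow> (real ^ 'n) set \<Rightarrow> real" where
  "sigma_inf D F X = sqrt (enn2real (noise_level D F X))"

locale stochastic_problem = prob_space D
  for D :: "'z measure" +
  fixes F :: "real ^ 'n \<Rightarrow> 'z \<Rightarrow> real"
    and X :: "(real ^ 'n) set"
    and L f_low :: real
  assumes closed_X: "closed X"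
    and convex_X: "convex X"
    and F_integrable: "integrable D (F x)"
    and objective_differentiable: "objective D F differentiable (at x)"
    and F_differentiable: "z \<in> space D \<Longrightarrow> (\<lambda>y. F y z) differentiable (at x)"
    and unbiased: "x \<in> X \<Longrightarrow>
      has_bochner_integral D (stoch_grad F x) (grad (objective D F) x)"
    and noise_finite: "noise_level D F X < \<infinity>"
    and L_nonneg: "0 \<le> L"
    and mean_square_smooth: "x \<in> X \<Longrightarrow> y \<in> X \<Longrightarrow>
      (\<integral>\<^sup>+z. ennreal ((infnorm (stoch_grad F x z - stoch_grad F y z))\<^sup>2) \<partial>D)
        \<le> ennreal (L\<^sup>2 * (norm1 (x - y))\<^sup>2)"
    and bounded_below: "x \<in> X \<Longrightarrow> f_low \<le> objective D F x"

text \<open>The comparison with \<open>1 mod q0\<close>, rather than \<open>1\<close>, matters for \<open>q0 = 1\<close>,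
  where every iteration is a restart.\<close>
definition restart :: "nat \<Rightarrow> nat \<Rightarrow> bool" where
  "restart q0 k \<longleftrightarrow> k mod q0 = 1 mod q0"

definition batch :: "nat \<Rightarrow> nat \<Rightarrow> nat \<Rightarrow> nat \<Rightarrow> nat" where
  "batch q0 m1 m k = (if restart q0 k then m1 else m)"

definition sample_complexity :: "nat \<Rightarrow> nat \<Rightarrow> nat \<Rightarrow> nat \<Rightarrow> nat" where
  "sample_complexity q0 m1 m K = (\<Sum>k=1..K. batch q0 m1 m k)"

text \<open>\<open>M\<close> is the underlying probability space, \<open>x k\<close> the iterates, \<open>G k\<close> the gradient estimates,
  \<open>\<zeta> k i\<close> the \<open>i\<close>-th sample drawn in iteration \<open>k\<close>, and \<open>Y\<close> the random output index.
  The starting point may be random.  The history before the sampling of iteration \<open>k\<close>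
  consists of the iterates up to \<open>k\<close> and the gradient estimates before \<open>k\<close>.\<close>
locale variance_reduced_method = prob_space M
  for M :: "'w measure" +
  fixes D :: "'z measure"
    and F :: "real ^ 'n \<Rightarrow> 'z \<Rightarrow> real"
    and X :: "(real ^ 'n) set"
    and \<phi> :: "real ^ 'n \<Rightarrow> real"
    and \<eta> p :: "nat \<Rightarrow> real"
    and q0 m1 m K :: nat
    and x G :: "nat \<Rightarrow> 'w \<Rightarrow> real ^ 'n"
    and \<zeta> :: "nat \<Rightarrow> nat \<Rightarrow> 'w \<Rightarrow> 'z"
    and Y :: "'w \<Rightarrow> nat"
  assumes counts_pos: "1 \<le> K" "1 \<le> q0" "1 \<le> m1" "1 \<le> m"
    and stepsize_pos: "k \<in> {1..K} \<Longrightarrow> 0 < \<eta> k"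
    and start: "\<omega> \<in> space M \<Longrightarrow> x 1 \<omega> \<in> X"
    and sample_law: "k \<in> {1..K} \<Longrightarrow> i \<in> {1..batch q0 m1 m k} \<Longrightarrow>
      \<zeta> k i \<in> measurable M D \<and> distr M D (\<zeta> k i) = D"
    and batch_indep: "k \<in> {1..K} \<Longrightarrow> indep_vars (\<lambda>_. D) (\<zeta> k) {1..batch q0 m1 m k}"
    and history_indep: "k \<in> {1..K} \<Longrightarrow>
      indep_rvs M
        ((\<Pi>\<^sub>M j\<in>{1..k}. borel) \<Otimes>\<^sub>M (\<Pi>\<^sub>M j\<in>{1..<k}. borel))
        (\<lambda>\<omega>. (\<lambda>j\<in>{1..k}. x j \<omega>, \<lambda>j\<in>{1..<k}. G j \<omega>))
        (\<Pi>\<^sub>M i\<in>{1..batch q0 m1 m k}. D)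
        (\<lambda>\<omega>. \<lambda>i\<in>{1..batch q0 m1 m k}. \<zeta> k i \<omega>)"
    and estimate_restart: "k \<in> {1..K} \<Longrightarrow> restart q0 k \<Longrightarrow> \<omega> \<in> space M \<Longrightarrow>
      G k \<omega> = (1 / real (batch q0 m1 m k)) *\<^sub>R
        (\<Sum>i=1..batch q0 m1 m k. stoch_grad F (x k \<omega>) (\<zeta> k i \<omega>))"
    and estimate_recursive: "k \<in> {1..K} \<Longrightarrow> \<not> restart q0 k \<Longrightarrow> \<omega> \<in> space M \<Longrightarrow>
      G k \<omega> = (1 / real (batch q0 m1 m k)) *\<^sub>R
        ((\<Sum>i=1..batch q0 m1 m k. stoch_grad F (x k \<omega>) (\<zeta> k i \<omega>))
          - (\<Sum>i=1..batch q0 m1 m k. stoch_grad F (x (k - 1) \<omega>) (\<zeta> k i \<omega>)))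
        + G (k - 1) \<omega>"
    and proximal_step: "k \<in> {1..K} \<Longrightarrow> \<omega> \<in> space M \<Longrightarrow>
      is_arg_min
        (\<lambda>y. 1 / 2 * (norm (y - (x k \<omega> - \<eta> k *\<^sub>R G k \<omega>)))\<^sup>2 + \<phi> (y - x k \<omega>))
        (\<lambda>y. y \<in> X) (x (k + 1) \<omega>)"
    and index_law: "k \<in> {1..K} \<Longrightarrow> prob {\<omega> \<in> space M. Y \<omega> = k} = p k"
    and index_range: "\<omega> \<in> space M \<Longrightarrow> Y \<omega> \<in> {1..K}"
    and index_indep:
      "indep_rvs M (count_space UNIV) Y
        (\<Pi>\<^sub>M k\<in>{1..K + 1}. borel) (\<lambda>\<omega>. \<lambda>k\<in>{1..K + 1}. x k \<omega>)"

text \<open>The factor in the stationarity bound, given in closed form because an existential quantifier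
  inside a statement about \<^typ>\<open>real ^ 'n\<close> would let it depend on the dimension.  With
  \<open>a = \<rho> / 4 - 1 / 2 - 4 / \<rho>\<close>, the mean squared step length is at most
  \<open>u * \<epsilon>\<^sup>2 / L\<^sup>2\<close> for \<open>u = (1 + 1 / \<rho>) / a = 4 * (\<rho> + 1) / (\<rho>\<^sup>2 - 2 * \<rho> - 16)\<close>, the mean squared
  estimation error is at most \<open>(1 + 4 * u) * \<epsilon>\<^sup>2\<close>, and the residual is bounded by \<open>(\<rho> + 2) * L\<close>
  times the step length plus the estimation error.\<close>
definition C3 :: "real \<Rightarrow> real" where
  "C3 \<rho> = 1 + 2 * (\<rho> + 4) * sqrt ((\<rho> + 1) / (\<rho>\<^sup>2 - 2 * \<rho> - 16))"

end

theory Submission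
  imports Defs
begin

text \<open>
  The errors of the gradient estimates are martingales between restarts.  The potential \<open>\<Phi>\<close>, the
  square of the norm of order \<open>2 * n\<close> with \<open>n\<close> about \<open>ln d\<close>, dominates \<open>infnorm\<^sup>2\<close> and is smooth with
  respect to \<open>infnorm\<close>, with constant at most \<open>\<Omega>\<^sup>2\<close>; expanding it at the history, the linear terms
  have mean zero, so \<open>E[\<Phi>(error)]\<close> grows by at most \<open>4 * \<Omega>\<^sup>2 * L\<^sup>2 / m\<close> times the squared step length
  per iteration and is at most \<open>\<Omega>\<^sup>2 * \<sigma>\<^sup>2 / m1 \<le> \<epsilon>\<^sup>2\<close> at a restart.  Summed over an interval this
  is absorbed, since \<open>\<Omega>\<^sup>2 * q0 \<le> m\<close>, by the decrease of the objective in a proximal step, which bounds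
  the mean squared step length.  The first-order condition of the proximal step bounds the residual
  by the step length plus the error.
\<close>

section \<open>The sum norm and the maximum norm\<close>

text \<open>Two obstacles shape the proof. The square of the maximum norm is not smooth, so sums of
  independent centred vectors have no cheap second-moment bound in it; a detour through the
  Euclidean norm would cost a factor \<open>d\<close>. The norm of order \<open>2 * n\<close> is the
  compromise: for \<open>n\<close> slightly above \<open>ln d\<close> it is within a constant factor
  of the maximum norm, while its smoothness constant grows only like \<open>n\<close>. The other
  obstacle is integrability: of the quantities along the run, only the initial objective value has
  finite expectation by hypothesis. Expectations are therefore extended nonnegative integrals,
  linear terms are discarded by a comparison that tolerates infinite values, and finiteness follows
  afterwards by induction. The duality of sum norm and maximum norm enters twice: as Hoelder's
  inequality in the descent estimate, and as a separation argument that turns an approximate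
  variational inequality into a short subgradient. The errors of an interval give back at most
  \<open>4 / \<rho> * L\<close> of the descent coefficient \<open>(\<rho> / 4 - 1 / 2) * L\<close>,
  and \<open>\<rho> \<ge> 6\<close> leaves a positive remainder.\<close>

lemma norm1_nonneg [simp]: "0 \<le> norm1 x"
  by (simp add: norm1_def sum_nonneg)

lemma norm1_zero [simp]: "norm1 0 = 0"
  by (simp add: norm1_def)

lemma norm1_triangle: "norm1 (x + y) \<le> norm1 x + norm1 y"
  unfolding norm1_def sum.distrib[symmetric] by (intro sum_mono) simp

lemma norm1_scaleR [simp]: "norm1 (c *\<^sub>R x) = \<bar>c\<bar> * norm1 x"
  by (simp add: norm1_def abs_mult sum_distrib_left)

lemma norm1_minus [simp]: "norm1 (- x) = norm1 x"
  by (simp add: norm1_def)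

lemma norm1_eq_0_iff [simp]: "norm1 x = 0 \<longleftrightarrow> x = 0"
  by (auto simp: norm1_def sum_nonneg_eq_0_iff vec_eq_iff)

lemma continuous_on_norm1 [continuous_intros]:
  "continuous_on A f \<Longrightarrow> continuous_on A (\<lambda>x. norm1 (f x))"
  unfolding norm1_def by (intro continuous_intros)

lemma borel_measurable_norm1 [measurable]: "norm1 \<in> borel_measurable borel"
  by (intro borel_measurable_continuous_onI continuous_intros)

lemma borel_measurable_infnorm [measurable]:
  "infnorm \<in> borel_measurable (borel :: 'a::euclidean_space measure)"
  by (intro borel_measurable_continuous_onI continuous_intros)

lemma infnorm_cart_attained: "\<exists>i. infnorm (x :: real ^ 'n) = \<bar>x $ i\<bar>"
proof -
  have "infnorm x = Max (range (\<lambda>i. \<bar>x $ i\<bar>))"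
    unfolding infnorm_cart by (subst cSup_eq_Max) (auto simp: full_SetCompr_eq)
  moreover have "Max (range (\<lambda>i. \<bar>x $ i\<bar>)) \<in> range (\<lambda>i. \<bar>x $ i\<bar>)"
    by (rule Max_in) auto
  ultimately show ?thesis by (metis rangeE)
qed

lemma infnorm_le_norm1: "infnorm x \<le> norm1 x"
proof -
  obtain i where "infnorm x = \<bar>x $ i\<bar>"
    using infnorm_cart_attained by blast
  then show ?thesis
    unfolding norm1_def using member_le_sum[of i UNIV "\<lambda>i. \<bar>x $ i\<bar>"] by simp
qed

lemma abs_inner_le_infnorm_norm1: "\<bar>v \<bullet> w\<bar> \<le> infnorm v * norm1 w"
proof -
  have "\<bar>v \<bullet> w\<bar> \<le> (\<Sum>i\<in>UNIV. \<bar>v $ i * w $ i\<bar>)"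
    unfolding inner_vec_def by (simp add: sum_abs)
  also have "\<dots> \<le> (\<Sum>i\<in>UNIV. infnorm v * \<bar>w $ i\<bar>)"
    by (intro sum_mono) (simp add: abs_mult mult_right_mono component_le_infnorm_cart)
  finally show ?thesis
    by (simp add: norm1_def sum_distrib_left)
qed

lemma infnorm_diff_power2: "(infnorm (x - y))\<^sup>2 \<le> 2 * (infnorm x)\<^sup>2 + 2 * (infnorm y)\<^sup>2"
proof -
  have "(infnorm (x - y))\<^sup>2 \<le> (infnorm x + infnorm y)\<^sup>2"
    using infnorm_triangle[of x "- y"] by (intro power_mono infnorm_pos_le) (simp add: infnorm_neg)
  also have "\<dots> \<le> 2 * (infnorm x)\<^sup>2 + 2 * (infnorm y)\<^sup>2"
    using sum_squares_bound[of "infnorm x" "infnorm y"] by (simp add: power2_sum)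
  finally show ?thesis .
qed

section \<open>A smooth potential for the maximum norm\<close>

text \<open>Bernoulli's inequality for \<open>s / a - 1\<close>, scaled by \<open>a ^ n\<close>: the
  power function lies above its tangent at \<open>a\<close>.\<close>

lemma power_mean_tangent:
  fixes a s :: real
  assumes "0 \<le> a" "0 \<le> s"
  shows "real n * a ^ (n - 1) * s \<le> real (n - 1) * a ^ n + s ^ n"
proof (cases "a = 0 \<or> n = 0")
  case True
  then show ?thesis using assms by (cases "n \<le> 1") (auto simp: power_0_left le_Suc_eq)
next
  case False
  then have a: "a > 0" and n: "n \<ge> 1" using assms by auto
  have "1 + real n * (s / a - 1) \<le> (1 + (s / a - 1)) ^ n"
    using assms a by (intro Bernoulli_inequality) auto
  then have "a ^ n * (1 + real n * (s / a - 1)) \<le> a ^ n * (s / a) ^ n"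
    using a by (intro mult_left_mono) auto
  also have "a ^ n * (s / a) ^ n = s ^ n"
    using a by (simp add: power_divide)
  also have "a ^ n * (1 + real n * (s / a - 1)) = real n * a ^ (n - 1) * s - real (n - 1) * a ^ n"
    using a n by (cases n) (auto simp: field_simps)
  finally show ?thesis by simp
qed

text \<open>The power mean inequality, obtained by summing the tangent inequality with one common
  \<open>s\<close>. Since \<open>S\<close> only has to bound the sum, a regularised sum can be
  inserted for it.\<close>

lemma sum_power_pred_le:
  fixes a :: "'a \<Rightarrow> real"
  assumes "finite I" "I \<noteq> {}" and a: "\<And>i. i \<in> I \<Longrightarrow> 0 \<le> a i" and n: "n \<ge> 1"
    and S: "0 < S" "(\<Sum>i\<in>I. a i ^ n) \<le> S"
  shows "(\<Sum>i\<in>I. a i ^ (n - 1)) \<le> real (card I) powr (1 / n) * S powr (1 - 1 / n)"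
proof -
  define N where "N = real (card I)"
  \<comment> \<open>Chosen so that \<open>N * s ^ n = S\<close>; the right sides of the tangent
    inequalities then add up to at most \<open>n * S\<close>.\<close>
  define s where "s = (S / N) powr (1 / n)"
  have N: "N > 0" using assms by (simp add: N_def card_gt_0_iff)
  have s: "s > 0" using S N by (simp add: s_def)
  have sn: "s ^ n = S / N"
    using S N n by (simp add: s_def powr_realpow[symmetric] powr_powr)
  have "real n * s * (\<Sum>i\<in>I. a i ^ (n - 1)) = (\<Sum>i\<in>I. real n * a i ^ (n - 1) * s)"
    by (simp add: sum_distrib_left mult_ac)
  also have "\<dots> \<le> (\<Sum>i\<in>I. real (n - 1) * a i ^ n + s ^ n)"
    using a s by (intro sum_mono power_mean_tangent) auto
  also have "\<dots> = real (n - 1) * (\<Sum>i\<in>I. a i ^ n) + N * s ^ n"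
    by (simp add: sum.distrib sum_distrib_left N_def)
  also have "\<dots> \<le> real (n - 1) * S + S"
    using S N sn by (intro add_mono mult_left_mono) auto
  also have "\<dots> = real n * S"
    using n by (simp add: algebra_simps of_nat_diff)
  finally have "s * (\<Sum>i\<in>I. a i ^ (n - 1)) \<le> S"
    using n by simp
  then have "(\<Sum>i\<in>I. a i ^ (n - 1)) \<le> S / s"
    using s by (simp add: field_simps)
  also have "S / s = N powr (1 / n) * S powr (1 - 1 / n)"
    using S N by (simp add: s_def powr_divide powr_diff field_simps)
  finally show ?thesis by (simp add: N_def)
qed

text \<open>The second derivative along a line through the origin needs \<open>\<delta> > 0\<close>; then \<open>\<delta> \<rightarrow> 0\<close>.\<close>

definition pnorm_sq :: "nat \<Rightarrow> real \<Rightarrow> real ^ 'n \<Rightarrow> real" where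
  "pnorm_sq n \<delta> x = (\<delta> + (\<Sum>i\<in>UNIV. (x $ i) ^ (2 * n))) powr (1 / n)"

text \<open>Taylor's formula of second order along \<open>t \<mapsto> x + t * y\<close>. With
  \<open>\<delta> > 0\<close> the base \<open>S t\<close> stays positive, so its powers can be
  differentiated, and the second derivative is bounded by \<open>2 * B\<close> uniformly in
  \<open>t\<close>.\<close>

lemma pnorm_sq_smooth_regularised:
  fixes x y :: "real ^ 'n"
  assumes n: "n \<ge> 1" and \<delta>: "\<delta> > 0"
  shows "pnorm_sq n \<delta> (x + y) \<le> pnorm_sq n \<delta> x
    + 2 * (\<delta> + (\<Sum>i\<in>UNIV. (x $ i) ^ (2 * n))) powr (1 / n - 1) * (\<Sum>i\<in>UNIV. (x $ i) ^ (2 * n - 1) * y $ i)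
    + real (2 * n - 1) * real CARD('n) powr (1 / n) * (infnorm y)\<^sup>2"
proof -
  define S where "S t = \<delta> + (\<Sum>i\<in>UNIV. (x $ i + t * y $ i) ^ (2 * n))" for t
  define S1 where "S1 t = (\<Sum>i\<in>UNIV. real (2 * n) * (x $ i + t * y $ i) ^ (2 * n - 1) * y $ i)" for t
  define S2 where
    "S2 t = (\<Sum>i\<in>UNIV. real (2 * n) * real (2 * n - 1) * (x $ i + t * y $ i) ^ (2 * n - 2) * (y $ i)\<^sup>2)" for t
  define h where "h t = S t powr (1 / n)" for t
  define h1 where "h1 t = (1 / n) * S t powr (1 / n - 1) * S1 t" for t
  define h2 where "h2 t = (1 / n) * (1 / n - 1) * S t powr (1 / n - 2) * (S1 t)\<^sup>2
     + (1 / n) * S t powr (1 / n - 1) * S2 t" for t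
  define B where "B = real (2 * n - 1) * real CARD('n) powr (1 / n) * (infnorm y)\<^sup>2"
  have Spos: "S t > 0" for t
    using \<delta> by (auto simp: S_def intro!: add_pos_nonneg sum_nonneg)
  have dS: "(S has_real_derivative S1 t) (at t)" for t
    unfolding S_def S1_def using n by (auto intro!: derivative_eq_intros sum.cong)
  have dS1: "(S1 has_real_derivative S2 t) (at t)" for t
    unfolding S1_def S2_def using n
    by (auto intro!: derivative_eq_intros sum.cong simp: power2_eq_square numeral_2_eq_2 of_nat_diff)
  have dh: "(h has_real_derivative h1 t) (at t)" for t
    unfolding h_def h1_def using DERIV_powr[OF dS Spos DERIV_const, of "1 / n" t] Spos[of t]
    by (simp add: powr_diff field_simps)
  have dh1: "(h1 has_real_derivative h2 t) (at t)" for t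
  proof -
    have "((\<lambda>t. S t powr (1 / n - 1)) has_real_derivative (1 / n - 1) * S t powr (1 / n - 2) * S1 t) (at t)"
      using DERIV_powr[OF dS Spos DERIV_const, of "1 / n - 1" t] Spos[of t]
      by (simp add: powr_diff power2_eq_square mult_ac)
    from DERIV_mult[OF DERIV_cmult[OF this, of "1 / n"] dS1] show ?thesis
      unfolding h1_def h2_def by (simp add: power2_eq_square mult_ac add.commute)
  qed
  have h2: "h2 t \<le> 2 * B" for t
  proof -
    let ?z = "\<lambda>i. x $ i + t * y $ i"
    have "(1 / real n) * (1 / n - 1) * S t powr (1 / n - 2) * (S1 t)\<^sup>2 \<le> 0"
      using n by (intro mult_nonpos_nonneg mult_nonneg_nonpos) auto
    then have *: "h2 t \<le> (1 / n) * S t powr (1 / n - 1) * S2 t"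
      by (simp add: h2_def)
    have "S2 t \<le> (\<Sum>i\<in>UNIV. real (2 * n) * real (2 * n - 1) * (?z i ^ (2 * n - 2) * (infnorm y)\<^sup>2))"
      unfolding S2_def
    proof (intro sum_mono)
      fix i
      have "(y $ i)\<^sup>2 \<le> (infnorm y)\<^sup>2"
        using component_le_infnorm_cart[of y i] power_mono[of "\<bar>y $ i\<bar>" "infnorm y" 2] by simp
      moreover have "0 \<le> ?z i ^ (2 * n - 2)"
        using n by (intro zero_le_even_power) auto
      ultimately show "real (2 * n) * real (2 * n - 1) * ?z i ^ (2 * n - 2) * (y $ i)\<^sup>2
         \<le> real (2 * n) * real (2 * n - 1) * (?z i ^ (2 * n - 2) * (infnorm y)\<^sup>2)"
        unfolding mult.assoc by (intro mult_left_mono) auto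
    qed
    also have "\<dots> = real (2 * n) * real (2 * n - 1) * (infnorm y)\<^sup>2 * (\<Sum>i\<in>UNIV. ((?z i)\<^sup>2) ^ (n - 1))"
      by (simp add: sum_distrib_left sum_distrib_right power_mult[symmetric] right_diff_distrib' mult_ac)
    also have "\<dots> \<le> real (2 * n) * real (2 * n - 1) * (infnorm y)\<^sup>2
        * (real CARD('n) powr (1 / n) * S t powr (1 - 1 / n))"
      using n \<delta> Spos[of t]
      by (intro mult_left_mono sum_power_pred_le) (auto simp: S_def power_mult[symmetric])
    finally have "(1 / n) * S t powr (1 / n - 1) * S2 t
      \<le> (1 / n) * S t powr (1 / n - 1) * (real (2 * n) * real (2 * n - 1) * (infnorm y)\<^sup>2
        * (real CARD('n) powr (1 / n) * S t powr (1 - 1 / n)))"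
      by (intro mult_left_mono) auto
    note order.trans[OF * this]
    also have "\<dots> = 2 * B * (S t powr (1 / n - 1) * S t powr (1 - 1 / n))"
      using n by (simp add: B_def)
    \<comment> \<open>The power mean bound on \<open>S2 t\<close> supplies exactly the reciprocal
      power, which frees the estimate of \<open>x\<close>, \<open>t\<close> and
      \<open>\<delta>\<close>.\<close>
    also have "S t powr (1 / n - 1) * S t powr (1 - 1 / n) = 1"
      using Spos[of t] by (simp add: powr_add[symmetric])
    finally show ?thesis by simp
  qed
  have "\<exists>t. 0 < t \<and> t < 1 \<and>
      h 1 = (\<Sum>m<2. ([h, h1, h2] ! m) 0 / fact m * 1 ^ m) + ([h, h1, h2] ! 2) t / fact 2 * 1 ^ 2"
    using dh dh1 by (intro Maclaurin) (auto simp: less_2_cases_iff)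
  then obtain t where "h 1 = h 0 + h1 0 + h2 t / 2"
    by (auto simp: numeral_2_eq_2)
  then have "h 1 \<le> h 0 + h1 0 + B"
    using h2[of t] by simp
  moreover have "h1 0 = 2 * S 0 powr (1 / n - 1) * (\<Sum>i\<in>UNIV. (x $ i) ^ (2 * n - 1) * y $ i)"
    using n by (simp add: h1_def S1_def sum_distrib_left mult_ac)
  ultimately show ?thesis
    by (simp add: h_def S_def pnorm_sq_def B_def)
qed

lemma pnorm_sq_smooth:
  fixes a :: "real ^ 'n"
  assumes n: "n \<ge> 1"
  shows "\<exists>g. \<forall>y. pnorm_sq n 0 (a + y) \<le> pnorm_sq n 0 a + g \<bullet> y
    + real (2 * n - 1) * real CARD('n) powr (1 / n) * (infnorm y)\<^sup>2"
proof (intro exI allI)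
  fix y :: "real ^ 'n"
  let ?B = "real (2 * n - 1) * real CARD('n) powr (1 / n) * (infnorm y)\<^sup>2"
  let ?S = "\<Sum>i\<in>UNIV. (a $ i) ^ (2 * n)"
  let ?T = "\<Sum>i\<in>UNIV. (a $ i) ^ (2 * n - 1) * y $ i"
  let ?g = "(2 * ?S powr (1 / n - 1)) *\<^sub>R (\<chi> i. (a $ i) ^ (2 * n - 1)) :: real ^ 'n"
  let ?F = "at_right (0::real)"
  have lim: "((\<lambda>\<delta>. pnorm_sq n \<delta> z) \<longlongrightarrow> pnorm_sq n 0 z) ?F" for z :: "real ^ 'n"
  proof -
    have "((\<lambda>\<delta>. \<delta> + (\<Sum>i\<in>UNIV. (z $ i) ^ (2 * n))) \<longlongrightarrow> 0 + (\<Sum>i\<in>UNIV. (z $ i) ^ (2 * n))) ?F"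
      by (intro tendsto_intros)
    then show ?thesis
      unfolding pnorm_sq_def using n
      by (intro tendsto_powr' tendsto_const)
         (auto intro!: eventually_at_rightI[of 0 1] add_nonneg_nonneg sum_nonneg zero_le_even_power)
  qed
  have lim': "((\<lambda>\<delta>. 2 * (\<delta> + ?S) powr (1 / n - 1) * ?T) \<longlongrightarrow> 2 * (0 + ?S) powr (1 / n - 1) * ?T) ?F"
  \<comment> \<open>At \<open>a = 0\<close> and \<open>n > 1\<close> the power has a negative
    exponent and blows up as \<open>\<delta>\<close> tends to 0, but there \<open>?T = 0\<close> and
    the whole product is constantly 0.\<close>
  proof (cases "?S = 0")
    case True
    then have "\<And>i. (a $ i) ^ (2 * n) = 0"
      by (subst (asm) sum_nonneg_eq_0_iff) (auto simp: zero_le_even_power)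
    then have "?T = 0" using n by (intro sum.neutral) auto
    then show ?thesis by simp
  next
    case False
    then show ?thesis by (intro tendsto_intros) auto
  qed
  have "pnorm_sq n 0 (a + y) \<le> pnorm_sq n 0 a + 2 * (0 + ?S) powr (1 / n - 1) * ?T + ?B"
  proof (rule tendsto_le[OF _ tendsto_add[OF tendsto_add[OF lim lim'] tendsto_const] lim])
    show "\<forall>\<^sub>F \<delta> in ?F. pnorm_sq n \<delta> (a + y) \<le> pnorm_sq n \<delta> a + 2 * (\<delta> + ?S) powr (1 / n - 1) * ?T + ?B"
      using pnorm_sq_smooth_regularised[OF n] by (intro eventually_at_rightI[of 0 1]) auto
  qed simp
  also have "2 * (0 + ?S) powr (1 / n - 1) * ?T = ?g \<bullet> y"
    by (simp add: inner_vec_def sum_distrib_left mult.assoc)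
  finally show "pnorm_sq n 0 (a + y) \<le> pnorm_sq n 0 a + ?g \<bullet> y + ?B" .
qed

lemma infnorm_le_pnorm_sq:
  fixes x :: "real ^ 'n"
  assumes n: "n \<ge> 1"
  shows "(infnorm x)\<^sup>2 \<le> pnorm_sq n 0 x"
proof -
  obtain i where i: "infnorm x = \<bar>x $ i\<bar>"
    using infnorm_cart_attained by blast
  have "(infnorm x) ^ (2 * n) \<le> (\<Sum>i\<in>UNIV. (x $ i) ^ (2 * n))"
    unfolding i power_even_abs[OF dvd_triv_left]
    by (rule member_le_sum) (auto simp: zero_le_even_power)
  then have "((infnorm x) ^ (2 * n)) powr (1 / n) \<le> pnorm_sq n 0 x"
    unfolding pnorm_sq_def by (intro powr_mono2) (auto simp: zero_le_even_power)
  moreover have "((infnorm x) ^ (2 * n)) powr (1 / n) = (infnorm x)\<^sup>2"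
  proof (cases "infnorm x = 0")
    case False
    then have "infnorm x > 0" using infnorm_pos_le[of x] by simp
    then have "(infnorm x) ^ (2 * n) = ((infnorm x)\<^sup>2) powr real n"
      by (subst powr_realpow) (auto simp: power_mult)
    then show ?thesis using n by (simp only: powr_powr) simp
  qed (use n in \<open>simp add: power_0_left\<close>)
  ultimately show ?thesis by simp
qed

text \<open>With \<open>n\<close> about \<open>ln d\<close> the factor \<open>d powr (1 / n)\<close> is at most \<open>e\<close>, so
  the smoothness constant is of order \<open>ln d\<close>; \<open>(e\<^sup>2 ln d)\<^sup>2\<close> leaves ample room.\<close>

lemma smooth_potential_exists:
  assumes d: "CARD('n) \<ge> 2"
  shows "\<exists>\<Phi> :: real ^ 'n \<Rightarrow> real. \<Phi> \<in> borel_measurable borel \<and> \<Phi> 0 = 0 \<and>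
    (\<forall>x. (infnorm x)\<^sup>2 \<le> \<Phi> x) \<and>
    (\<forall>a. \<exists>g. \<forall>y. \<Phi> (a + y) \<le> \<Phi> a + g \<bullet> y + (exp 2 * ln (real CARD('n)))\<^sup>2 * (infnorm y)\<^sup>2)"
proof -
  define l where "l = ln (real CARD('n))"
  define n where "n = nat \<lceil>l\<rceil>"
  have "ln 2 \<le> l" using d by (simp add: l_def)
  then have l: "l \<ge> 2 / 3" using ln2_ge_two_thirds by linarith
  have n: "n \<ge> 1" "l \<le> real n" "real n \<le> l + 1"
    using l unfolding n_def by linarith+
  have e2: "2 \<le> exp (1::real)" using exp_ge_add_one_self[of 1] by simp
  have e: "8 \<le> exp (3::real)"
    using power_mono[OF e2, of 3] exp_of_nat_mult[of 3 "1::real"] by simp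
  have "real CARD('n) powr (1 / n) = exp (l / n)"
    using d by (simp add: powr_def l_def)
  also have "\<dots> \<le> exp 1" using n by simp
  finally have "real (2 * n - 1) * real CARD('n) powr (1 / n) \<le> (2 * l + 1) * exp 1"
    using n l by (intro mult_mono) (auto simp: of_nat_diff)
  \<comment> \<open>True for \<open>l \<ge> 1 / 2\<close>, hence for \<open>d \<ge> 2\<close>. The
    factor \<open>exp 4\<close> of \<open>(exp 2 * l)\<^sup>2\<close> is then split:
    \<open>exp 3\<close> absorbs the 8 and \<open>exp 1\<close> is the bound on the power of
    \<open>d\<close>.\<close>
  also have "2 * l + 1 \<le> 8 * l\<^sup>2"
  proof -
    have "2 / 3 * l \<le> l * l"
      using l by (intro mult_right_mono) auto
    then show ?thesis
      using l unfolding power2_eq_square by linarith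
  qed
  also have "8 * l\<^sup>2 \<le> exp 3 * l\<^sup>2"
    using e by (intro mult_right_mono) auto
  also have "exp 3 * l\<^sup>2 * exp 1 = (exp 2 * l)\<^sup>2"
    by (simp add: power2_eq_square mult_exp_exp mult_ac)
  finally have C: "real (2 * n - 1) * real CARD('n) powr (1 / n) \<le> (exp 2 * l)\<^sup>2"
    by simp
  show ?thesis
    unfolding l_def[symmetric]
  proof (rule exI[of _ "pnorm_sq n 0"], intro conjI allI)
    show "pnorm_sq n 0 \<in> borel_measurable (borel :: (real ^ 'n) measure)"
      unfolding pnorm_sq_def by measurable
    show "pnorm_sq n 0 0 = 0" using n by (simp add: pnorm_sq_def power_0_left)
    show "(infnorm x)\<^sup>2 \<le> pnorm_sq n 0 x" for x :: "real ^ 'n"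
      using infnorm_le_pnorm_sq n by blast
    fix a :: "real ^ 'n"
    obtain g where g: "\<And>y. pnorm_sq n 0 (a + y) \<le> pnorm_sq n 0 a + g \<bullet> y
        + real (2 * n - 1) * real CARD('n) powr (1 / n) * (infnorm y)\<^sup>2"
      using pnorm_sq_smooth n by blast
    show "\<exists>g. \<forall>y. pnorm_sq n 0 (a + y) \<le> pnorm_sq n 0 a + g \<bullet> y + (exp 2 * l)\<^sup>2 * (infnorm y)\<^sup>2"
      using C by (intro exI[of _ g] allI order.trans[OF g] add_left_mono mult_right_mono) auto
  qed
qed

section \<open>Independent sums and measurability of gradients\<close>

text \<open>Lets a linear term of mean zero be dropped inside extended integrals: either
  \<open>w\<close> has infinite integral and nothing is to be shown, or \<open>w\<close> is
  integrable, so \<open>u\<close> is too by domination, and real integrals can be compared.\<close>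

lemma nn_integral_mono_mean_zero:
  fixes u w h :: "'a \<Rightarrow> real"
  assumes h: "has_bochner_integral M h 0"
    and [measurable]: "u \<in> borel_measurable M" "w \<in> borel_measurable M"
    and nonneg: "\<And>x. x \<in> space M \<Longrightarrow> 0 \<le> u x" "\<And>x. x \<in> space M \<Longrightarrow> 0 \<le> w x"
    and le: "\<And>x. x \<in> space M \<Longrightarrow> u x \<le> w x + h x"
  shows "(\<integral>\<^sup>+x. ennreal (u x) \<partial>M) \<le> (\<integral>\<^sup>+x. ennreal (w x) \<partial>M)"
proof (cases "(\<integral>\<^sup>+x. ennreal (w x) \<partial>M) = \<infinity>")
  case False
  have ih: "integrable M h" and h0: "integral\<^sup>L M h = 0"
    using h by (auto simp: has_bochner_integral_iff)
  have iw: "integrable M w"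
    using False nonneg by (intro integrableI_nonneg) (auto simp: top.not_eq_extremum)
  have iu: "integrable M u"
    by (rule Bochner_Integration.integrable_bound[OF Bochner_Integration.integrable_add[OF iw ih]])
       (use nonneg le in \<open>auto intro!: AE_I2 order.trans[OF _ abs_ge_self]\<close>)
  have "integral\<^sup>L M u \<le> (\<integral>x. w x + h x \<partial>M)"
    using iu iw ih le by (intro integral_mono) auto
  also have "\<dots> = integral\<^sup>L M w"
    using iw ih h0 by simp
  finally show ?thesis
    using iu iw nonneg by (subst (1 2) nn_integral_eq_integral) (auto intro: ennreal_leI)
qed simp

text \<open>Smoothness takes the place of the orthogonality that a Euclidean norm would offer: the
  gradient of the potential at the fixed point \<open>a\<close> is paired with a centred vector and
  vanishes in the mean.\<close>

lemma (in prob_space) nn_integral_potential_step: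
  fixes \<xi> :: "'a \<Rightarrow> real ^ 'n" and \<Phi> :: "real ^ 'n \<Rightarrow> real"
  assumes \<xi>: "has_bochner_integral M \<xi> 0"
    and [measurable]: "\<Phi> \<in> borel_measurable borel"
    and \<Phi>: "\<And>x. 0 \<le> \<Phi> x" and C: "0 \<le> C"
    and g: "\<And>y. \<Phi> (a + y) \<le> \<Phi> a + g \<bullet> y + C * (infnorm y)\<^sup>2"
  shows "(\<integral>\<^sup>+x. ennreal (\<Phi> (a + \<xi> x)) \<partial>M)
    \<le> ennreal (\<Phi> a) + ennreal C * (\<integral>\<^sup>+x. ennreal ((infnorm (\<xi> x))\<^sup>2) \<partial>M)"
proof -
  have [measurable]: "\<xi> \<in> borel_measurable M"
    using \<xi> by (auto simp: has_bochner_integral_iff)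
  have "(\<integral>\<^sup>+x. ennreal (\<Phi> (a + \<xi> x)) \<partial>M) \<le> (\<integral>\<^sup>+x. ennreal (\<Phi> a + C * (infnorm (\<xi> x))\<^sup>2) \<partial>M)"
  proof (rule nn_integral_mono_mean_zero)
    show "has_bochner_integral M (\<lambda>x. g \<bullet> \<xi> x) 0"
      using has_bochner_integral_inner_right[of g M \<xi> 0] \<xi> by simp
    show "\<Phi> (a + \<xi> x) \<le> \<Phi> a + C * (infnorm (\<xi> x))\<^sup>2 + g \<bullet> \<xi> x" for x
      using g[of "\<xi> x"] by simp
  qed (use \<Phi> C in auto)
  also have "\<dots> = ennreal (\<Phi> a) + ennreal C * (\<integral>\<^sup>+x. ennreal ((infnorm (\<xi> x))\<^sup>2) \<partial>M)"
    using \<Phi> C by (simp add: ennreal_plus ennreal_mult nn_integral_add nn_integral_cmult emeasure_space_1)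
  finally show ?thesis .
qed

text \<open>One sample is integrated out at a time, with the partial sum of the others absorbed into
  \<open>a\<close>. The cost is linear in the number of samples, whereas the triangle inequality
  would make it quadratic.\<close>

lemma (in prob_space) nn_integral_potential_sum:
  fixes \<xi> :: "'a \<Rightarrow> real ^ 'n" and \<Phi> :: "real ^ 'n \<Rightarrow> real"
  assumes I: "finite I" and \<xi>: "has_bochner_integral M \<xi> 0"
    and [measurable]: "\<Phi> \<in> borel_measurable borel"
    and \<Phi>: "\<And>x. 0 \<le> \<Phi> x" and C: "0 \<le> C"
    and smooth: "\<And>a. \<exists>g. \<forall>y. \<Phi> (a + y) \<le> \<Phi> a + g \<bullet> y + C * (infnorm y)\<^sup>2"
  shows "(\<integral>\<^sup>+z. ennreal (\<Phi> (a + (\<Sum>i\<in>I. \<xi> (z i)))) \<partial>Pi\<^sub>M I (\<lambda>_. M))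
    \<le> ennreal (\<Phi> a) + of_nat (card I) * (ennreal C * (\<integral>\<^sup>+x. ennreal ((infnorm (\<xi> x))\<^sup>2) \<partial>M))"
  using I
proof (induction I rule: finite_induct)
  case empty
  interpret P: prob_space "Pi\<^sub>M {} (\<lambda>_. M)" by (rule prob_space_PiM) (rule prob_space_axioms)
  show ?case by (simp add: P.emeasure_space_1 del: space_PiM_empty)
next
  case (insert j J)
  interpret P: product_prob_space "\<lambda>_. M" J ..
  have [measurable]: "\<xi> \<in> borel_measurable M"
    using \<xi> by (auto simp: has_bochner_integral_iff)
  let ?V = "ennreal C * (\<integral>\<^sup>+x. ennreal ((infnorm (\<xi> x))\<^sup>2) \<partial>M)"
  have "(\<integral>\<^sup>+z. ennreal (\<Phi> (a + (\<Sum>i\<in>insert j J. \<xi> (z i)))) \<partial>Pi\<^sub>M (insert j J) (\<lambda>_. M))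
    = (\<integral>\<^sup>+z. (\<integral>\<^sup>+y. ennreal (\<Phi> (a + (\<Sum>i\<in>insert j J. \<xi> ((z(j := y)) i)))) \<partial>M) \<partial>Pi\<^sub>M J (\<lambda>_. M))"
    using insert by (intro P.product_nn_integral_insert) (auto, measurable)
  also have "\<dots> = (\<integral>\<^sup>+z. (\<integral>\<^sup>+y. ennreal (\<Phi> ((a + (\<Sum>i\<in>J. \<xi> (z i))) + \<xi> y)) \<partial>M) \<partial>Pi\<^sub>M J (\<lambda>_. M))"
  proof -
    have "(\<Sum>i\<in>J. \<xi> ((z(j := y)) i)) = (\<Sum>i\<in>J. \<xi> (z i))" for z y
      using insert by (intro sum.cong) auto
    then show ?thesis using insert by (simp add: add_ac)
  qed
  also have "\<dots> \<le> (\<integral>\<^sup>+z. ennreal (\<Phi> (a + (\<Sum>i\<in>J. \<xi> (z i)))) + ?V \<partial>Pi\<^sub>M J (\<lambda>_. M))"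
  proof (intro nn_integral_mono)
    fix z
    obtain g where "\<And>y. \<Phi> ((a + (\<Sum>i\<in>J. \<xi> (z i))) + y)
        \<le> \<Phi> (a + (\<Sum>i\<in>J. \<xi> (z i))) + g \<bullet> y + C * (infnorm y)\<^sup>2"
      using smooth by blast
    then show "(\<integral>\<^sup>+y. ennreal (\<Phi> ((a + (\<Sum>i\<in>J. \<xi> (z i))) + \<xi> y)) \<partial>M)
        \<le> ennreal (\<Phi> (a + (\<Sum>i\<in>J. \<xi> (z i)))) + ?V"
      using \<xi> \<Phi> C by (intro nn_integral_potential_step) auto
  qed
  also have "\<dots> = (\<integral>\<^sup>+z. ennreal (\<Phi> (a + (\<Sum>i\<in>J. \<xi> (z i)))) \<partial>Pi\<^sub>M J (\<lambda>_. M)) + ?V"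
    by (subst nn_integral_add) (auto simp: P.P.emeasure_space_1)
  also have "\<dots> \<le> (ennreal (\<Phi> a) + of_nat (card J) * ?V) + ?V"
    by (intro add_mono insert.IH order.refl)
  also have "\<dots> = ennreal (\<Phi> a) + of_nat (card (insert j J)) * ?V"
    using insert by (simp add: algebra_simps)
  finally show ?case .
qed

text \<open>Independence makes the joint law a product measure, so Tonelli's theorem allows
  \<open>U\<close> to be frozen while \<open>V\<close> is integrated out.\<close>

lemma (in prob_space) nn_integral_indep_rvs:
  assumes indep: "indep_rvs M S U T V" and f: "f \<in> borel_measurable (S \<Otimes>\<^sub>M T)"
  shows "(\<integral>\<^sup>+\<omega>. f (U \<omega>, V \<omega>) \<partial>M) = (\<integral>\<^sup>+\<omega>. (\<integral>\<^sup>+v. f (U \<omega>, v) \<partial>distr M T V) \<partial>M)"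
proof -
  have [measurable]: "U \<in> measurable M S" "V \<in> measurable M T"
    using indep by (auto simp: indep_rvs_def)
  note [measurable] = f
  interpret U: prob_space "distr M S U" by (rule prob_space_distr) simp
  interpret V: prob_space "distr M T V" by (rule prob_space_distr) simp
  interpret UV: pair_prob_space "distr M S U" "distr M T V" ..
  have eq: "distr M S U \<Otimes>\<^sub>M distr M T V = distr M (S \<Otimes>\<^sub>M T) (\<lambda>\<omega>. (U \<omega>, V \<omega>))"
  proof (rule pair_measure_eqI)
    fix A B assume A: "A \<in> sets (distr M S U)" and B: "B \<in> sets (distr M T V)"
    then have [measurable]: "A \<in> sets S" "B \<in> sets T" by auto
    have "prob ((U -` A \<inter> space M) \<inter> (V -` B \<inter> space M)) = prob (U -` A \<inter> space M) * prob (V -` B \<inter> space M)"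
      using indep A B by (intro indep_setD[where A = "{U -` A \<inter> space M |A. A \<in> sets S}" and B = "{V -` B \<inter> space M |B. B \<in> sets T}"])
        (auto simp: indep_rvs_def)
    moreover have "(\<lambda>\<omega>. (U \<omega>, V \<omega>)) -` (A \<times> B) \<inter> space M = (U -` A \<inter> space M) \<inter> (V -` B \<inter> space M)"
      by auto
    ultimately show "emeasure (distr M S U) A * emeasure (distr M T V) B
        = emeasure (distr M (S \<Otimes>\<^sub>M T) (\<lambda>\<omega>. (U \<omega>, V \<omega>))) (A \<times> B)"
      by (simp add: emeasure_distr emeasure_eq_measure ennreal_mult)
  qed (auto intro: U.sigma_finite_measure_axioms V.sigma_finite_measure_axioms cong: sets_pair_measure_cong)
  have "(\<integral>\<^sup>+\<omega>. f (U \<omega>, V \<omega>) \<partial>M) = integral\<^sup>N (distr M S U \<Otimes>\<^sub>M distr M T V) f"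
    unfolding eq by (simp add: nn_integral_distr)
  also have "\<dots> = (\<integral>\<^sup>+u. (\<integral>\<^sup>+v. f (u, v) \<partial>distr M T V) \<partial>distr M S U)"
    by (rule V.nn_integral_fst[symmetric]) (simp cong: measurable_cong_sets sets_pair_measure_cong)
  also have "\<dots> = (\<integral>\<^sup>+\<omega>. (\<integral>\<^sup>+v. f (U \<omega>, v) \<partial>distr M T V) \<partial>M)"
    by (subst nn_integral_distr) (auto intro!: V.borel_measurable_nn_integral_fst)
  finally show ?thesis .
qed

section \<open>Measurability of gradients, jointly in the point and the sample\<close>

lemma borel_measurable_Caratheodory:
  fixes f :: "real ^ 'n \<Rightarrow> 'z \<Rightarrow> real"
  assumes meas: "\<And>x. f x \<in> borel_measurable D"
    and cont: "\<And>z x. z \<in> space D \<Longrightarrow> isCont (\<lambda>x. f x z) x"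
  shows "(\<lambda>(x, z). f x z) \<in> borel_measurable (borel \<Otimes>\<^sub>M D)"
proof (rule borel_measurable_LIMSEQ_real)
  \<comment> \<open>\<open>q n (k n x)\<close> is the corner of the cell containing \<open>x\<close>
    in a grid of mesh \<open>1 / Suc n\<close>. Only countably many corners exist, so evaluating
    \<open>f\<close> there is jointly measurable, and continuity in \<open>x\<close> gives the
    limit.\<close>
  define k :: "nat \<Rightarrow> real ^ 'n \<Rightarrow> 'n \<Rightarrow> int" where "k n x = (\<lambda>i. \<lfloor>real (Suc n) * x $ i\<rfloor>)" for n x
  define q :: "nat \<Rightarrow> ('n \<Rightarrow> int) \<Rightarrow> real ^ 'n" where "q n j = (\<chi> i. real_of_int (j i) / real (Suc n))" for n j
  show "(\<lambda>n. (\<lambda>(x, z). f (q n (k n x)) z) w) \<longlonglongrightarrow> (\<lambda>(x, z). f x z) w"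
    if "w \<in> space (borel \<Otimes>\<^sub>M D)" for w :: "(real ^ 'n) \<times> 'z"
  proof -
    obtain x z where w: "w = (x, z)" by (cases w)
    have lim: "(\<lambda>n. q n (k n x)) \<longlonglongrightarrow> x"
    proof (rule vec_tendstoI)
      fix i
      have "(\<lambda>n. real_of_int \<lfloor>real (Suc n) * x $ i\<rfloor> / real (Suc n)) \<longlonglongrightarrow> x $ i"
      proof (rule tendsto_sandwich)
        show "\<forall>\<^sub>F n in sequentially. x $ i - 1 / real (Suc n) \<le> real_of_int \<lfloor>real (Suc n) * x $ i\<rfloor> / real (Suc n)"
        proof (intro always_eventually allI)
          fix n
          have "real (Suc n) * x $ i - 1 \<le> real_of_int \<lfloor>real (Suc n) * x $ i\<rfloor>" by linarith
          then have "(real (Suc n) * x $ i - 1) / real (Suc n) \<le> real_of_int \<lfloor>real (Suc n) * x $ i\<rfloor> / real (Suc n)"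
            by (rule divide_right_mono) simp
          then show "x $ i - 1 / real (Suc n) \<le> real_of_int \<lfloor>real (Suc n) * x $ i\<rfloor> / real (Suc n)"
            by (simp add: diff_divide_distrib)
        qed
        show "\<forall>\<^sub>F n in sequentially. real_of_int \<lfloor>real (Suc n) * x $ i\<rfloor> / real (Suc n) \<le> x $ i"
        proof (intro always_eventually allI)
          fix n
          show "real_of_int \<lfloor>real (Suc n) * x $ i\<rfloor> / real (Suc n) \<le> x $ i"
            by (subst pos_divide_le_eq) (auto simp del: of_nat_Suc simp: mult.commute)
        qed
        show "(\<lambda>n. x $ i - 1 / real (Suc n)) \<longlonglongrightarrow> x $ i"
          using tendsto_diff[OF tendsto_const LIMSEQ_Suc[OF lim_1_over_n]] by simp
      qed simp
      then show "(\<lambda>n. q n (k n x) $ i) \<longlonglongrightarrow> x $ i"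
        by (simp add: q_def k_def)
    qed
    show ?thesis
      using isCont_tendsto_compose[OF cont lim, of z] that w by (simp add: space_pair_measure)
  qed
  fix n
  have k: "(\<lambda>w. k n (fst w)) \<in> measurable (borel \<Otimes>\<^sub>M D) (count_space UNIV)"
  proof (rule measurable_compose[OF measurable_fst])
    have "k n -` {j} \<in> sets borel" for j
    proof -
      have "k n -` {j} = {x. \<forall>i. \<lfloor>real (Suc n) * x $ i\<rfloor> = j i}"
        by (auto simp: k_def fun_eq_iff)
      also have "\<dots> \<in> sets borel" by measurable
      finally show ?thesis .
    qed
    then show "k n \<in> measurable borel (count_space UNIV)"
      by (subst measurable_count_space_eq2_countable) auto
  qed
  have "(\<lambda>w. f (q n (k n (fst w))) (snd w)) \<in> borel_measurable (borel \<Otimes>\<^sub>M D)"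
    by (rule measurable_compose_countable[OF _ k]) (rule measurable_compose[OF measurable_snd meas])
  then show "(\<lambda>(x, z). f (q n (k n x)) z) \<in> borel_measurable (borel \<Otimes>\<^sub>M D)"
    by (simp add: case_prod_beta)
qed

text \<open>Since \<open>grad\<close> is a definite description, existence has to come from
  representing the derivative in the basis, and uniqueness from that of the derivative.\<close>

lemma GDERIV_grad:
  fixes f :: "'a::euclidean_space \<Rightarrow> real"
  assumes "f differentiable (at x)"
  shows "GDERIV f x :> grad f x"
proof -
  obtain f' where f': "(f has_derivative f') (at x)"
    using assms by (auto simp: differentiable_def)
  then interpret f': bounded_linear f' by (rule has_derivative_bounded_linear)
  define g where "g = (\<Sum>b\<in>Basis. f' b *\<^sub>R b)"
  have "f' h = h \<bullet> g" for h
  proof -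
    have "f' h = f' (\<Sum>b\<in>Basis. (h \<bullet> b) *\<^sub>R b)" by (simp add: euclidean_representation)
    also have "\<dots> = (\<Sum>b\<in>Basis. (h \<bullet> b) * f' b)" by (simp add: f'.sum f'.scaleR)
    finally show ?thesis by (simp add: g_def inner_sum_right mult.commute)
  qed
  then have g: "GDERIV f x :> g"
    using f' unfolding gderiv_def by presburger
  moreover have "g' = g" if "GDERIV f x :> g'" for g'
  proof -
    have "(\<lambda>h. h \<bullet> g') = (\<lambda>h. h \<bullet> g)"
      using has_derivative_unique that g unfolding gderiv_def by blast
    then have "\<forall>h. h \<bullet> (g' - g) = 0" by (simp add: fun_eq_iff inner_diff_right)
    then have "(g' - g) \<bullet> (g' - g) = 0" by blast
    then show ?thesis by simp
  qed
  ultimately show ?thesis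
    unfolding grad_def by (rule theI)
qed

text \<open>A sequence of difference quotients, rather than a limit over all real increments, so
  that measurability passes to the limit.\<close>

lemma grad_LIMSEQ:
  fixes f :: "'a::euclidean_space \<Rightarrow> real"
  assumes "f differentiable (at x)"
  shows "(\<lambda>n. real (Suc n) * (f (x + (1 / real (Suc n)) *\<^sub>R b) - f x)) \<longlonglongrightarrow> grad f x \<bullet> b"
proof -
  have "((\<lambda>t. x + t *\<^sub>R b) has_derivative (\<lambda>t. t *\<^sub>R b)) (at 0)"
    by (auto intro!: derivative_eq_intros)
  from has_derivative_compose[OF this] GDERIV_grad[OF assms]
  have "((\<lambda>t. f (x + t *\<^sub>R b)) has_derivative (\<lambda>t. (t *\<^sub>R b) \<bullet> grad f x)) (at 0)"
    unfolding gderiv_def by fastforce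
  moreover have "(\<lambda>t. (t *\<^sub>R b) \<bullet> grad f x) = (*) (grad f x \<bullet> b)"
    by (simp add: fun_eq_iff inner_commute)
  ultimately have "((\<lambda>t. f (x + t *\<^sub>R b)) has_real_derivative grad f x \<bullet> b) (at 0)"
    unfolding has_field_derivative_def by simp
  then have "((\<lambda>t. (f (x + t *\<^sub>R b) - f x) / t) \<longlongrightarrow> grad f x \<bullet> b) (at 0)"
    by (simp add: DERIV_def)
  moreover have "filterlim (\<lambda>n. 1 / real (Suc n)) (at 0) sequentially"
    unfolding filterlim_at using LIMSEQ_Suc[OF lim_1_over_n] by auto
  ultimately have "(\<lambda>n. (f (x + (1 / real (Suc n)) *\<^sub>R b) - f x) / (1 / real (Suc n))) \<longlonglongrightarrow> grad f x \<bullet> b"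
    by (rule filterlim_compose)
  then show ?thesis by (simp add: mult.commute)
qed

text \<open>Joint measurability is what allows a random iterate to be inserted as the point. It is
  checked on components, each a limit of difference quotients of \<open>F\<close>.\<close>

lemma borel_measurable_stoch_grad:
  fixes F :: "real ^ 'n \<Rightarrow> 'z \<Rightarrow> real"
  assumes meas: "\<And>x. F x \<in> borel_measurable D"
    and diff: "\<And>z x. z \<in> space D \<Longrightarrow> (\<lambda>y. F y z) differentiable (at x)"
  shows "(\<lambda>(x, z). stoch_grad F x z) \<in> borel_measurable (borel \<Otimes>\<^sub>M D)"
proof (subst borel_measurable_euclidean_space, intro ballI)
  fix b :: "real ^ 'n"
  have [measurable]: "(\<lambda>(x, z). F x z) \<in> borel_measurable (borel \<Otimes>\<^sub>M D)"
    using meas diff by (intro borel_measurable_Caratheodory differentiable_imp_continuous_within) auto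
  have F [measurable]: "(\<lambda>w. F (h w) (snd w)) \<in> borel_measurable (borel \<Otimes>\<^sub>M D)"
    if [measurable]: "h \<in> borel_measurable (borel \<Otimes>\<^sub>M D)" for h :: "(real ^ 'n) \<times> 'z \<Rightarrow> real ^ 'n"
  proof -
    have "(\<lambda>w. (\<lambda>(x, z). F x z) (h w, snd w)) \<in> borel_measurable (borel \<Otimes>\<^sub>M D)"
      by measurable
    then show ?thesis by simp
  qed
  show "(\<lambda>w. (case w of (x, z) \<Rightarrow> stoch_grad F x z) \<bullet> b) \<in> borel_measurable (borel \<Otimes>\<^sub>M D)"
  proof (rule borel_measurable_LIMSEQ_real)
    show "(\<lambda>n. (\<lambda>w. real (Suc n) * (F (fst w + (1 / real (Suc n)) *\<^sub>R b) (snd w) - F (fst w) (snd w))) w)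
        \<longlonglongrightarrow> (case w of (x, z) \<Rightarrow> stoch_grad F x z) \<bullet> b"
      if "w \<in> space (borel \<Otimes>\<^sub>M D)" for w :: "(real ^ 'n) \<times> 'z"
      using grad_LIMSEQ[OF diff] that by (auto simp: space_pair_measure stoch_grad_def)
  qed measurable
qed

text \<open>A gradient need not be continuous on the whole space, but its components are limits of
  difference quotients of a continuous function.\<close>

lemma borel_measurable_grad:
  fixes f :: "real ^ 'n \<Rightarrow> real"
  assumes diff: "\<And>x. f differentiable (at x)"
  shows "grad f \<in> borel_measurable borel"
proof (subst borel_measurable_euclidean_space, intro ballI)
  fix b :: "real ^ 'n"
  have "continuous_on UNIV f"
    using diff by (simp add: continuous_on_eq_continuous_within differentiable_imp_continuous_within)
  then have [measurable]: "f \<in> borel_measurable borel"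
    by (rule borel_measurable_continuous_onI)
  show "(\<lambda>x. grad f x \<bullet> b) \<in> borel_measurable borel"
    by (rule borel_measurable_LIMSEQ_real[where u = "\<lambda>n x. real (Suc n) * (f (x + (1 / real (Suc n)) *\<^sub>R b) - f x)"])
       (use grad_LIMSEQ[OF diff] in auto)
qed

section \<open>Stationarity and the proximal step\<close>

text \<open>A Hahn-Banach sandwich: a hyperplane between the strict epigraph of
  \<open>c * norm1\<close> and the hypograph of \<open>u \<mapsto> - (b \<bullet> u)\<close> over
  the translated set yields a linear functional between the two functions. Its bound by
  \<open>c * norm1\<close> is a bound by \<open>c\<close> in the dual norm, which is
  \<open>infnorm\<close>.\<close>

lemma convex_sublinear_separation:
  fixes b x :: "real ^ 'n"
  assumes X: "convex X" "x \<in> X" and c: "0 \<le> c"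
    and nonneg: "\<And>y. y \<in> X \<Longrightarrow> 0 \<le> b \<bullet> (y - x) + c * norm1 (y - x)"
  shows "\<exists>w. infnorm w \<le> c \<and> (\<forall>y\<in>X. 0 \<le> (b + w) \<bullet> (y - x))"
proof -
  \<comment> \<open>The strict inequality keeps \<open>S\<close> disjoint from \<open>T\<close>,
    although the closed epigraph meets \<open>T\<close> at the origin.\<close>
  define S :: "((real ^ 'n) \<times> real) set" where "S = {(u, r) | u r. c * norm1 u < r}"
  define T where "T = {(u, r) | u r. x + u \<in> X \<and> r \<le> - (b \<bullet> u)}"
  have "convex S"
  proof (rule convexI)
    fix P P' :: "(real ^ 'n) \<times> real" and p q :: real
    assume "P \<in> S" "P' \<in> S" and pq: "0 \<le> p" "0 \<le> q" "p + q = 1"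
    then obtain u r v s where P: "P = (u, r)" "P' = (v, s)" "c * norm1 u < r" "c * norm1 v < s"
      by (auto simp: S_def)
    then have "p * (c * norm1 u) + q * (c * norm1 v) < p * r + q * s"
      using convex_bound_lt[of "c * norm1 u - r" 0 "c * norm1 v - s" p q] pq by (simp add: algebra_simps)
    moreover have "c * norm1 (p *\<^sub>R u + q *\<^sub>R v) \<le> c * (p * norm1 u + q * norm1 v)"
      using norm1_triangle[of "p *\<^sub>R u" "q *\<^sub>R v"] pq c by (intro mult_left_mono) auto
    ultimately show "p *\<^sub>R P + q *\<^sub>R P' \<in> S"
      by (simp add: S_def P algebra_simps)
  qed
  moreover have "convex T"
  proof (rule convexI)
    fix P P' :: "(real ^ 'n) \<times> real" and p q :: real
    assume "P \<in> T" "P' \<in> T" and pq: "0 \<le> p" "0 \<le> q" "p + q = 1"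
    then obtain u r v s where P: "P = (u, r)" "P' = (v, s)"
      and uv: "x + u \<in> X" "x + v \<in> X" "r \<le> - (b \<bullet> u)" "s \<le> - (b \<bullet> v)"
      by (auto simp: T_def)
    have q: "q = 1 - p" using pq(3) by simp
    have "p *\<^sub>R (x + u) + q *\<^sub>R (x + v) \<in> X"
      using X(1) uv pq by (simp add: convex_def)
    moreover have "p *\<^sub>R (x + u) + q *\<^sub>R (x + v) = x + (p *\<^sub>R u + q *\<^sub>R v)"
      unfolding q by (simp add: algebra_simps)
    moreover have "p * r + q * s \<le> p * (- (b \<bullet> u)) + q * (- (b \<bullet> v))"
      using uv pq by (intro add_mono mult_left_mono)
    ultimately show "p *\<^sub>R P + q *\<^sub>R P' \<in> T"
      by (simp add: T_def P inner_add_right)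
  qed
  moreover have T0: "(0, 0) \<in> T"
    using X by (simp add: T_def)
  moreover have S0: "(0, r) \<in> S" if "r > 0" for r
    using that by (simp add: S_def)
  moreover have "T \<inter> S = {}"
  proof -
    have False if "x + u \<in> X" "c * norm1 u < r" "r \<le> - (b \<bullet> u)" for u r
      using nonneg[OF that(1)] that by simp
    then show ?thesis by (auto simp: S_def T_def)
  qed
  moreover have "T \<noteq> {}" "S \<noteq> {}"
    using T0 S0[of 1] by auto
  ultimately have "\<exists>a \<beta>. a \<noteq> 0 \<and> (\<forall>p\<in>T. a \<bullet> p \<le> \<beta>) \<and> (\<forall>p\<in>S. a \<bullet> p \<ge> \<beta>)"
    by (intro separating_hyperplane_sets)
  then obtain a \<beta> where a: "a \<noteq> 0" "\<And>p. p \<in> T \<Longrightarrow> a \<bullet> p \<le> \<beta>" "\<And>p. p \<in> S \<Longrightarrow> a \<bullet> p \<ge> \<beta>"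
    by blast
  obtain \<alpha> \<gamma> where \<alpha>: "a = (\<alpha>, \<gamma>)" by (cases a)
  have \<beta>: "0 \<le> \<beta>" using a(2)[OF T0] by (simp add: \<alpha>)
  have S: "0 \<le> \<alpha> \<bullet> u + \<gamma> * r" if "c * norm1 u < r" for u r
    using a(3)[of "(u, r)"] that \<beta> by (simp add: S_def \<alpha>)
  have "0 \<le> \<gamma>" using S[of 0 1] by simp
  \<comment> \<open>The hyperplane is not vertical, because \<open>S\<close> has points above every
    \<open>u\<close>, in particular above \<open>- \<alpha>\<close>.\<close>
  moreover have "\<gamma> \<noteq> 0"
  proof
    assume \<gamma>: "\<gamma> = 0"
    have "0 \<le> \<alpha> \<bullet> (- \<alpha>)" using S[of "- \<alpha>" "c * norm1 (- \<alpha>) + 1"] \<gamma> by simp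
    then have "\<alpha> = 0" using inner_ge_zero[of \<alpha>] by (simp add: order.antisym)
    then show False using a(1) \<alpha> \<gamma> by (simp add: zero_prod_def)
  qed
  ultimately have \<gamma>: "\<gamma> > 0" by simp
  have "\<beta> \<le> 0"
  proof (rule field_le_epsilon)
    fix e :: real assume "e > 0"
    then show "\<beta> \<le> 0 + e"
      using a(3)[OF S0[of "e / \<gamma>"]] \<gamma> by (simp add: \<alpha>)
  qed
  have S': "0 \<le> \<alpha> \<bullet> u + \<gamma> * (c * norm1 u)" for u
  proof (rule field_le_epsilon)
    fix e :: real assume "e > 0"
    then show "0 \<le> \<alpha> \<bullet> u + \<gamma> * (c * norm1 u) + e"
      using S[of u "c * norm1 u + e / \<gamma>"] \<gamma> by (simp add: algebra_simps)
  qed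
  define w where "w = (- (1 / \<gamma>)) *\<^sub>R \<alpha>"
  have "infnorm w \<le> c"
  proof -
    obtain i where i: "infnorm w = \<bar>w $ i\<bar>" using infnorm_cart_attained by blast
    have n: "norm1 (axis i 1 :: real ^ 'n) = 1"
      by (simp add: norm1_def axis_def if_distrib cong: if_cong)
    \<comment> \<open>The signed unit vectors are the extreme points of the unit ball of
      \<open>norm1\<close>; testing on them gives the dual norm.\<close>
    have "0 \<le> \<alpha> $ i + \<gamma> * c" "0 \<le> - \<alpha> $ i + \<gamma> * c"
      using S'[of "axis i 1"] S'[of "- axis i 1"] n by (simp_all add: inner_axis)
    then have "\<bar>\<alpha> $ i\<bar> \<le> c * \<gamma>" by (simp add: abs_le_iff mult.commute)
    then show ?thesis
      unfolding i using \<gamma> by (simp add: w_def abs_mult pos_divide_le_eq)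
  qed
  moreover have "0 \<le> (b + w) \<bullet> (y - x)" if "y \<in> X" for y
  proof -
    have "\<alpha> \<bullet> (y - x) - \<gamma> * (b \<bullet> (y - x)) \<le> 0"
      using a(2)[of "(y - x, - (b \<bullet> (y - x)))"] \<open>\<beta> \<le> 0\<close> that by (simp add: T_def \<alpha>)
    then have "(\<alpha> \<bullet> (y - x)) / \<gamma> \<le> b \<bullet> (y - x)"
      unfolding pos_divide_le_eq[OF \<gamma>] by (simp add: mult.commute)
    then show ?thesis by (simp add: w_def inner_diff_left)
  qed
  ultimately show ?thesis by blast
qed

text \<open>Off \<open>X\<close> the difference quotient is infinite; on \<open>X\<close> the normal
  vector can only increase it compared with the differentiable case. This one inclusion suffices to
  bound the distance from above.\<close>

lemma frechet_subdiff_add_indicator: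
  fixes f :: "'a::euclidean_space \<Rightarrow> real"
  assumes f: "f differentiable (at x)" and x: "x \<in> X"
    and normal: "\<And>y. y \<in> X \<Longrightarrow> n \<bullet> (y - x) \<le> 0"
  shows "grad f x + n \<in> frechet_subdiff (\<lambda>y. ereal (f y) + indicator_fun X y) x"
proof -
  let ?g = "\<lambda>y. ereal (f y) + indicator_fun X y"
  let ?v = "grad f x + n"
  let ?q = "\<lambda>y. (?g y - ?g x - ereal (?v \<bullet> (y - x))) / ereal (norm (y - x))"
  have lim: "((\<lambda>y. norm (f y - f x - (y - x) \<bullet> grad f x) / norm (y - x)) \<longlongrightarrow> 0) (at x)"
    using GDERIV_grad[OF f] unfolding gderiv_def has_derivative_iff_norm by auto
  have "0 \<le> Liminf (at x) ?q"
  proof (subst le_Liminf_iff, intro allI impI)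
    fix c :: ereal assume "c < 0"
    \<comment> \<open>A real number in between is needed, since \<open>c\<close> may be minus
      infinity.\<close>
    then obtain c' where c': "c \<le> ereal c'" "c' < 0"
      using ereal_dense2[of c 0] by (metis ereal_less(2) less_imp_le zero_ereal_def ereal_less_eq(3) less_ereal.simps(1))
    have "\<forall>\<^sub>F y in at x. norm (f y - f x - (y - x) \<bullet> grad f x) / norm (y - x) < - c'"
      using order_tendstoD(2)[OF lim] c' by simp
    then show "\<forall>\<^sub>F y in at x. c < ?q y"
      using eventually_neq_at_within[of x x UNIV]
    proof eventually_elim
      case (elim y)
      then have y: "norm (y - x) > 0" by simp
      show ?case
      proof (cases "y \<in> X")
        case True
        have "- (f y - f x - (y - x) \<bullet> grad f x) < - c' * norm (y - x)"
          using elim(1) y by (simp add: pos_divide_less_eq abs_less_iff)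
        then have "c' * norm (y - x) < f y - f x - ?v \<bullet> (y - x)"
          using normal[OF True] inner_commute[of "y - x" "grad f x"] by (simp add: inner_add_left)
        then have "c' < (f y - f x - ?v \<bullet> (y - x)) / norm (y - x)"
          using y by (simp add: pos_less_divide_eq)
        moreover have "?q y = ereal ((f y - f x - ?v \<bullet> (y - x)) / norm (y - x))"
          using True x y by (simp add: indicator_fun_def)
        ultimately show ?thesis using c' by (simp add: order.strict_trans1)
      next
        case False
        then have "?q y = \<infinity>" using x y by (simp add: indicator_fun_def)
        then show ?thesis using c' by (auto intro: order.strict_trans1)
      qed
    qed
  qed
  then show ?thesis using x by (simp add: frechet_subdiff_def indicator_fun_def)
qed

text \<open>By separation, the slack \<open>c * norm1\<close> of the variational inequality is
  represented by a vector \<open>w\<close> with \<open>infnorm w \<le> c\<close> for which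
  \<open>- (grad f x + w)\<close> is normal to \<open>X\<close>; the subgradient exhibited is
  \<open>- w\<close>.\<close>

lemma dist_inf_zero_frechet_subdiff_le:
  fixes f :: "real ^ 'n \<Rightarrow> real"
  assumes f: "f differentiable (at x)" and X: "convex X" "x \<in> X" and c: "0 \<le> c"
    and nonneg: "\<And>y. y \<in> X \<Longrightarrow> 0 \<le> grad f x \<bullet> (y - x) + c * norm1 (y - x)"
  shows "dist_inf_zero (frechet_subdiff (\<lambda>y. ereal (f y) + indicator_fun X y) x) \<le> ennreal c"
proof -
  obtain w where w: "infnorm w \<le> c" "\<And>y. y \<in> X \<Longrightarrow> 0 \<le> (grad f x + w) \<bullet> (y - x)"
    using convex_sublinear_separation[OF X c nonneg] by blast
  have "grad f x + (- (grad f x + w)) \<in> frechet_subdiff (\<lambda>y. ereal (f y) + indicator_fun X y) x"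
    using w(2) by (intro frechet_subdiff_add_indicator f X) (simp only: inner_minus_left neg_le_0_iff_le)
  then have "- w \<in> frechet_subdiff (\<lambda>y. ereal (f y) + indicator_fun X y) x"
    by simp
  then have "dist_inf_zero (frechet_subdiff (\<lambda>y. ereal (f y) + indicator_fun X y) x) \<le> ennreal (infnorm (- w))"
    unfolding dist_inf_zero_def by (rule INF_lower)
  also have "\<dots> \<le> ennreal c" using w by (simp add: infnorm_neg ennreal_leI)
  finally show ?thesis .
qed

text \<open>The output index is independent of the iterates but not of the gradient estimates, so the
  distance has to be bounded by a Borel function of the iterate alone.\<close>

lemma measurable_residual_exists:
  fixes f :: "real ^ 'n \<Rightarrow> real"
  assumes f: "\<And>x. f differentiable (at x)" and X: "convex X"
  shows "\<exists>R \<in> borel_measurable borel.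
    (\<forall>x\<in>X. dist_inf_zero (frechet_subdiff (\<lambda>y. ereal (f y) + indicator_fun X y) x) \<le> R x) \<and>
    (\<forall>x\<in>X. \<forall>c\<ge>0. (\<forall>y\<in>X. 0 \<le> grad f x \<bullet> (y - x) + c * norm1 (y - x)) \<longrightarrow> R x \<le> ennreal c)"
proof -
  obtain Q where Q: "countable Q" "Q \<subseteq> X" "X \<subseteq> closure Q"
    using separable[of X] by blast
  \<comment> \<open>For \<open>x\<close> in \<open>X\<close> this is the least slack in the
    variational inequality. Countability of \<open>Q\<close> gives measurability, and density with
    continuity extends the inequality to \<open>X\<close>. At \<open>y = x\<close> the quotient is 0
    by the convention on division, and negative quotients are truncated to 0.\<close>
  define R where "R x = (SUP y\<in>Q. ennreal (- (grad f x \<bullet> (y - x)) / norm1 (y - x)))" for x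
  note [measurable] = borel_measurable_grad[OF f]
  have "R \<in> borel_measurable borel"
    unfolding R_def using Q(1) by measurable
  moreover have "dist_inf_zero (frechet_subdiff (\<lambda>y. ereal (f y) + indicator_fun X y) x) \<le> R x" if x: "x \<in> X" for x
  proof (cases "R x")
    case (real c)
    have "0 \<le> grad f x \<bullet> (y - x) + c * norm1 (y - x)" if y: "y \<in> X" for y
    proof (rule continuous_ge_on_closure[where S = Q and f = "\<lambda>y. grad f x \<bullet> (y - x) + c * norm1 (y - x)"])
      show "continuous_on (closure Q) (\<lambda>y. grad f x \<bullet> (y - x) + c * norm1 (y - x))"
        by (intro continuous_intros)
      show "y \<in> closure Q" using Q y by blast
      fix z assume z: "z \<in> Q"
      show "0 \<le> grad f x \<bullet> (z - x) + c * norm1 (z - x)"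
      proof (cases "z = x")
        case False
        then have n: "norm1 (z - x) > 0" by (simp add: order.not_eq_order_implies_strict)
        have "ennreal (- (grad f x \<bullet> (z - x)) / norm1 (z - x)) \<le> ennreal c"
          using real(2) z unfolding R_def by (metis (no_types, lifting) SUP_upper)
        then have "- (grad f x \<bullet> (z - x)) / norm1 (z - x) \<le> c"
          using real(1) by (simp add: ennreal_le_iff)
        then show ?thesis unfolding pos_divide_le_eq[OF n] by simp
      qed simp
    qed
    then show ?thesis
      using dist_inf_zero_frechet_subdiff_le[OF f X x real(1)] real(2) by simp
  qed simp
  moreover have "R x \<le> ennreal c"
    if x: "x \<in> X" and c: "0 \<le> c" and y: "\<forall>y\<in>X. 0 \<le> grad f x \<bullet> (y - x) + c * norm1 (y - x)" for x c
    unfolding R_def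
  proof (rule SUP_least)
    fix z assume "z \<in> Q"
    then have z: "0 \<le> grad f x \<bullet> (z - x) + c * norm1 (z - x)" using y Q by blast
    have "- (grad f x \<bullet> (z - x)) / norm1 (z - x) \<le> c"
    proof (cases "z = x")
      case False
      then have n: "norm1 (z - x) > 0" by (simp add: order.not_eq_order_implies_strict)
      from z show ?thesis unfolding pos_divide_le_eq[OF n] by simp
    qed (use c in simp)
    then show "ennreal (- (grad f x \<bullet> (z - x)) / norm1 (z - x)) \<le> ennreal c"
      by (rule ennreal_leI)
  qed
  ultimately show ?thesis by blast
qed

text \<open>The minimiser \<open>v\<close> is compared with \<open>v + l * (y - v)\<close>, and
  \<open>l\<close> tends to 0 after division by \<open>l\<close>. As \<open>norm1\<close> is not
  differentiable, the triangle inequality supplies an upper bound on its directional growth.\<close>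

lemma prox_first_order:
  fixes x v G :: "real ^ 'n"
  assumes X: "convex X" and y: "y \<in> X" and \<rho>: "0 \<le> \<rho>"
    and min: "is_arg_min (\<lambda>y. 1 / 2 * (norm (y - (x - \<eta> *\<^sub>R G)))\<^sup>2 + \<rho> / 2 * (norm1 (y - x))\<^sup>2) (\<lambda>y. y \<in> X) v"
  shows "0 \<le> (v - x + \<eta> *\<^sub>R G) \<bullet> (y - v) + \<rho> * norm1 (v - x) * norm1 (y - v)"
proof -
  define b where "b = v - x + \<eta> *\<^sub>R G"
  define u where "u = y - v"
  define A where "A = b \<bullet> u + \<rho> * norm1 (v - x) * norm1 u"
  define B where "B = 1 / 2 * (norm u)\<^sup>2 + \<rho> / 2 * (norm1 u)\<^sup>2"
  have v: "v \<in> X" using min by (simp add: is_arg_min_def)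
  have "0 \<le> A + l * B" if l: "0 < l" "l < 1" for l
  proof -
    have "(1 - l) *\<^sub>R v + l *\<^sub>R y \<in> X"
      using X v y l by (simp add: convex_alt)
    moreover have "(1 - l) *\<^sub>R v + l *\<^sub>R y = v + l *\<^sub>R u"
      by (simp add: u_def algebra_simps)
    ultimately have "v + l *\<^sub>R u \<in> X" by simp
    then have "1 / 2 * (norm (v - (x - \<eta> *\<^sub>R G)))\<^sup>2 + \<rho> / 2 * (norm1 (v - x))\<^sup>2
       \<le> 1 / 2 * (norm (v + l *\<^sub>R u - (x - \<eta> *\<^sub>R G)))\<^sup>2 + \<rho> / 2 * (norm1 (v + l *\<^sub>R u - x))\<^sup>2"
      using min unfolding is_arg_min_def by (meson not_le)
    moreover have "v + l *\<^sub>R u - (x - \<eta> *\<^sub>R G) = b + l *\<^sub>R u" by (simp add: b_def)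
    moreover have "v - (x - \<eta> *\<^sub>R G) = b" by (simp add: b_def)
    moreover have "\<rho> / 2 * (norm1 (v + l *\<^sub>R u - x))\<^sup>2 \<le> \<rho> / 2 * (norm1 (v - x) + l * norm1 u)\<^sup>2"
      using norm1_triangle[of "v - x" "l *\<^sub>R u"] l \<rho>
      by (intro mult_left_mono power_mono) (auto simp: algebra_simps)
    moreover have "(norm (b + l *\<^sub>R u))\<^sup>2 = (norm b)\<^sup>2 + 2 * l * (b \<bullet> u) + l\<^sup>2 * (norm u)\<^sup>2"
      unfolding power2_norm_eq_inner by (simp add: inner_simps inner_commute power2_eq_square)
    ultimately have "1 / 2 * (norm b)\<^sup>2 + \<rho> / 2 * (norm1 (v - x))\<^sup>2
       \<le> 1 / 2 * ((norm b)\<^sup>2 + 2 * l * (b \<bullet> u) + l\<^sup>2 * (norm u)\<^sup>2) + \<rho> / 2 * (norm1 (v - x) + l * norm1 u)\<^sup>2"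
      by simp
    also have "\<dots> = 1 / 2 * (norm b)\<^sup>2 + \<rho> / 2 * (norm1 (v - x))\<^sup>2 + l * (A + l * B)"
      by (simp add: A_def B_def field_simps power2_eq_square)
    finally have "0 \<le> l * (A + l * B)" by simp
    then show ?thesis using l by (simp add: zero_le_mult_iff)
  qed
  moreover have "((\<lambda>l. A + l * B) \<longlongrightarrow> A + 0 * B) (at_right 0)"
    by (intro tendsto_intros)
  ultimately have "0 \<le> A + 0 * B"
    by (intro tendsto_lowerbound[of _ _ "at_right 0"]) (auto intro!: eventually_at_rightI[of 0 1])
  then show ?thesis by (simp add: A_def b_def u_def)
qed

text \<open>The auxiliary function \<open>h\<close> has nonpositive derivative along the segment,
  which convexity keeps inside \<open>X\<close>, where the Lipschitz bound is available.
  Monotonicity replaces integration of the gradient.\<close>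

lemma smooth_quadratic_upper_bound:
  fixes f :: "real ^ 'n \<Rightarrow> real"
  assumes f: "\<And>x. f differentiable (at x)" and X: "convex X" "x \<in> X" "y \<in> X"
    and lip: "\<And>x y. x \<in> X \<Longrightarrow> y \<in> X \<Longrightarrow> infnorm (grad f x - grad f y) \<le> L * norm1 (x - y)"
  shows "f y \<le> f x + grad f x \<bullet> (y - x) + L / 2 * (norm1 (y - x))\<^sup>2"
proof -
  define u where "u = y - x"
  define h where "h t = f (x + t *\<^sub>R u) - t * (grad f x \<bullet> u) - L / 2 * (norm1 u)\<^sup>2 * t\<^sup>2" for t
  have "h 1 \<le> h 0"
  proof (rule DERIV_nonpos_imp_nonincreasing[where f = h])
    fix t :: real assume t: "0 \<le> t" "t \<le> 1"
    have "((\<lambda>t. x + t *\<^sub>R u) has_derivative (\<lambda>t. t *\<^sub>R u)) (at t)"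
      by (auto intro!: derivative_eq_intros)
    from has_derivative_compose[OF this] GDERIV_grad[OF f]
    have "((\<lambda>t. f (x + t *\<^sub>R u)) has_derivative (\<lambda>s. (s *\<^sub>R u) \<bullet> grad f (x + t *\<^sub>R u))) (at t)"
      unfolding gderiv_def by fastforce
    moreover have "(\<lambda>s. (s *\<^sub>R u) \<bullet> grad f (x + t *\<^sub>R u)) = (*) (grad f (x + t *\<^sub>R u) \<bullet> u)"
      by (simp add: fun_eq_iff inner_commute)
    ultimately have "((\<lambda>t. f (x + t *\<^sub>R u)) has_real_derivative grad f (x + t *\<^sub>R u) \<bullet> u) (at t)"
      unfolding has_field_derivative_def by simp
    then have "(h has_real_derivative
        grad f (x + t *\<^sub>R u) \<bullet> u - grad f x \<bullet> u - L * (norm1 u)\<^sup>2 * t) (at t)"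
      unfolding h_def by (auto intro!: derivative_eq_intros)
    moreover have "(grad f (x + t *\<^sub>R u) - grad f x) \<bullet> u \<le> L * (norm1 u)\<^sup>2 * t"
    proof -
      have "(1 - t) *\<^sub>R x + t *\<^sub>R y \<in> X" using X t by (simp add: convex_alt)
      moreover have "(1 - t) *\<^sub>R x + t *\<^sub>R y = x + t *\<^sub>R u" by (simp add: u_def algebra_simps)
      ultimately have "infnorm (grad f (x + t *\<^sub>R u) - grad f x) \<le> L * norm1 (x + t *\<^sub>R u - x)"
        using X lip by metis
      then have "infnorm (grad f (x + t *\<^sub>R u) - grad f x) * norm1 u \<le> L * (t * norm1 u) * norm1 u"
        using t by (intro mult_right_mono) auto
      then show ?thesis
        using abs_inner_le_infnorm_norm1[of "grad f (x + t *\<^sub>R u) - grad f x" u]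
        by (simp add: power2_eq_square mult_ac)
    qed
    ultimately show "\<exists>d. (h has_real_derivative d) (at t) \<and> d \<le> 0"
      by (intro exI conjI) (auto simp: inner_diff_left)
  qed simp
  then show ?thesis by (simp add: h_def u_def)
qed

section \<open>Consequences of the stochastic assumptions at fixed points of
  \<open>X\<close>\<close>

context stochastic_problem
begin

lemma F_borel_measurable [measurable]: "F x \<in> borel_measurable D"
  by (rule borel_measurable_integrable[OF F_integrable])

lemma stoch_grad_measurable:
  "(\<lambda>(x, z). stoch_grad F x z) \<in> borel_measurable (borel \<Otimes>\<^sub>M D)"
  by (rule borel_measurable_stoch_grad[OF F_borel_measurable F_differentiable])

lemma grad_objective_measurable: "grad (objective D F) \<in> borel_measurable borel"
  by (rule borel_measurable_grad[OF objective_differentiable])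

text \<open>Jensen's inequality for the coordinate \<open>i\<close> that attains the maximum norm of
  the mean, in the form \<open>c\<^sup>2 \<le> \<xi>\<^sup>2 + 2 * c * (c - \<xi>)\<close> with a
  last term of mean zero.\<close>

lemma grad_objective_lipschitz:
  assumes x: "x \<in> X" and y: "y \<in> X"
  shows "infnorm (grad (objective D F) x - grad (objective D F) y) \<le> L * norm1 (x - y)"
proof -
  define \<xi> where "\<xi> z = stoch_grad F x z - stoch_grad F y z" for z
  define v where "v = grad (objective D F) x - grad (objective D F) y"
  have \<xi>: "has_bochner_integral D \<xi> v"
    unfolding \<xi>_def v_def by (intro has_bochner_integral_diff unbiased x y)
  obtain i where i: "infnorm v = \<bar>v $ i\<bar>" using infnorm_cart_attained by blast
  define c where "c = v $ i"
  have "has_bochner_integral D (\<lambda>z. \<xi> z \<bullet> axis i 1) (v \<bullet> axis i 1)"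
    by (intro has_bochner_integral_inner_left \<xi>)
  then have \<xi>i: "has_bochner_integral D (\<lambda>z. \<xi> z $ i) c"
    by (simp add: inner_axis c_def)
  have "(\<integral>\<^sup>+z. ennreal (c\<^sup>2) \<partial>D) \<le> (\<integral>\<^sup>+z. ennreal ((infnorm (\<xi> z))\<^sup>2) \<partial>D)"
  proof (rule nn_integral_mono_mean_zero)
    have "has_bochner_integral D (\<lambda>z. 2 * c * (c - \<xi> z $ i)) (2 * c * (c - c))"
      using \<xi>i by (simp add: has_bochner_integral_iff prob_space)
    then show "has_bochner_integral D (\<lambda>z. 2 * c * (c - \<xi> z $ i)) 0" by simp
    fix z
    have "c\<^sup>2 \<le> (\<xi> z $ i)\<^sup>2 + 2 * c * (c - \<xi> z $ i)"
      using sum_squares_bound[of "\<xi> z $ i" c] by (simp add: power2_eq_square algebra_simps)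
    moreover have "(\<xi> z $ i)\<^sup>2 \<le> (infnorm (\<xi> z))\<^sup>2"
      using component_le_infnorm_cart[of "\<xi> z" i] power_mono[of "\<bar>\<xi> z $ i\<bar>" "infnorm (\<xi> z)" 2] by simp
    ultimately show "c\<^sup>2 \<le> (infnorm (\<xi> z))\<^sup>2 + 2 * c * (c - \<xi> z $ i)" by linarith
    show "(\<lambda>z. c\<^sup>2) \<in> borel_measurable D"
      by (rule borel_measurable_const)
    show "(\<lambda>z. (infnorm (\<xi> z))\<^sup>2) \<in> borel_measurable D"
      by (intro borel_measurable_power measurable_compose[OF _ borel_measurable_infnorm]
          borel_measurable_has_bochner_integral[OF \<xi>])
  qed (rule zero_le_power2)+
  also have "\<dots> \<le> ennreal (L\<^sup>2 * (norm1 (x - y))\<^sup>2)"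
    unfolding \<xi>_def by (rule mean_square_smooth[OF x y])
  finally have "ennreal (c\<^sup>2) \<le> ennreal ((L * norm1 (x - y))\<^sup>2)"
    by (simp add: emeasure_space_1 power_mult_distrib)
  then have "c\<^sup>2 \<le> (L * norm1 (x - y))\<^sup>2"
    by (subst (asm) ennreal_le_iff) auto
  then have "\<bar>c\<bar> \<le> L * norm1 (x - y)"
    using L_nonneg power2_le_imp_le[of "\<bar>c\<bar>"] by simp
  then show ?thesis using i by (simp add: c_def v_def)
qed

lemma nn_integral_noise_le:
  assumes x: "x \<in> X"
  shows "(\<integral>\<^sup>+z. ennreal ((infnorm (stoch_grad F x z - grad (objective D F) x))\<^sup>2) \<partial>D)
    \<le> ennreal ((sigma_inf D F X)\<^sup>2)"
proof -
  have "(\<integral>\<^sup>+z. ennreal ((infnorm (stoch_grad F x z - grad (objective D F) x))\<^sup>2) \<partial>D) \<le> noise_level D F X"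
    unfolding noise_level_def by (rule SUP_upper[OF x])
  also have "noise_level D F X = ennreal (enn2real (noise_level D F X))"
    using noise_finite by (intro ennreal_enn2real[symmetric]) (simp only: infinity_ennreal_def)
  also have "enn2real (noise_level D F X) = (sigma_inf D F X)\<^sup>2"
    unfolding sigma_inf_def by (rule real_sqrt_pow2[OF enn2real_nonneg, symmetric])
  finally show ?thesis .
qed

text \<open>In the maximum norm, unlike the Euclidean one, subtracting the mean can increase the
  second moment. Hence the crude split into two squares, each contributing
  \<open>2 * L\<^sup>2\<close>.\<close>

lemma nn_integral_centred_diff_le:
  assumes x: "x \<in> X" and y: "y \<in> X"
  shows "(\<integral>\<^sup>+z. ennreal ((infnorm (stoch_grad F x z - stoch_grad F y z
      - (grad (objective D F) x - grad (objective D F) y)))\<^sup>2) \<partial>D)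
    \<le> ennreal (4 * L\<^sup>2 * (norm1 (x - y))\<^sup>2)"
proof -
  let ?v = "grad (objective D F) x - grad (objective D F) y"
  let ?\<xi> = "\<lambda>z. stoch_grad F x z - stoch_grad F y z"
  have [measurable]: "stoch_grad F x \<in> borel_measurable D" "stoch_grad F y \<in> borel_measurable D"
    using unbiased x y borel_measurable_has_bochner_integral by blast+
  have "(infnorm ?v)\<^sup>2 \<le> (L * norm1 (x - y))\<^sup>2"
    using grad_objective_lipschitz[OF x y] by (intro power_mono infnorm_pos_le)
  then have "2 * (infnorm (?\<xi> z))\<^sup>2 + 2 * (infnorm ?v)\<^sup>2
      \<le> 2 * (infnorm (?\<xi> z))\<^sup>2 + 2 * (L\<^sup>2 * (norm1 (x - y))\<^sup>2)" for z
    by (simp add: power_mult_distrib)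
  note order.trans[OF infnorm_diff_power2 this]
  then have "(\<integral>\<^sup>+z. ennreal ((infnorm (?\<xi> z - ?v))\<^sup>2) \<partial>D)
      \<le> (\<integral>\<^sup>+z. ennreal (2 * (infnorm (?\<xi> z))\<^sup>2 + 2 * (L\<^sup>2 * (norm1 (x - y))\<^sup>2)) \<partial>D)"
    by (intro nn_integral_mono ennreal_leI)
  also have "\<dots> = 2 * (\<integral>\<^sup>+z. ennreal ((infnorm (?\<xi> z))\<^sup>2) \<partial>D) + 2 * ennreal (L\<^sup>2 * (norm1 (x - y))\<^sup>2)"
    by (simp add: ennreal_plus ennreal_mult nn_integral_add nn_integral_cmult emeasure_space_1)
  also have "\<dots> \<le> 2 * ennreal (L\<^sup>2 * (norm1 (x - y))\<^sup>2) + 2 * ennreal (L\<^sup>2 * (norm1 (x - y))\<^sup>2)"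
    using mean_square_smooth[OF x y] by (intro add_right_mono mult_left_mono) auto
  also have "\<dots> = ennreal (4 * L\<^sup>2 * (norm1 (x - y))\<^sup>2)"
    by (simp add: ennreal_mult mult.assoc flip: distrib_right)
  finally show ?thesis .
qed

text \<open>Comparing \<open>v\<close> with the competitor \<open>x\<close> gives \<open>G \<bullet>
  (v - x) \<le> - (\<rho> * L / 2) * (norm1 (v - x))\<^sup>2\<close>. Half of this gain pays for the
  estimation error and \<open>L / 2\<close> for the curvature of the objective, which leaves
  \<open>(\<rho> / 4 - 1 / 2) * L\<close>.\<close>

lemma prox_step_descent:
  fixes x v G :: "real ^ 'n"
  assumes L: "0 < L" and \<rho>: "0 < \<rho>" and x: "x \<in> X"
    and min: "is_arg_min (\<lambda>y. 1 / 2 * (norm (y - (x - (1 / L) *\<^sub>R G)))\<^sup>2 + \<rho> / 2 * (norm1 (y - x))\<^sup>2) (\<lambda>y. y \<in> X) v"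
  shows "objective D F v + (\<rho> / 4 - 1 / 2) * L * (norm1 (v - x))\<^sup>2
    \<le> objective D F x + 1 / (\<rho> * L) * (infnorm (G - grad (objective D F) x))\<^sup>2"
proof -
  let ?f = "objective D F"
  define \<Delta> where "\<Delta> = v - x"
  define e where "e = G - grad ?f x"
  have v: "v \<in> X" using min by (simp add: is_arg_min_def)
  have "1 / 2 * (norm (v - (x - (1 / L) *\<^sub>R G)))\<^sup>2 + \<rho> / 2 * (norm1 (v - x))\<^sup>2
      \<le> 1 / 2 * (norm (x - (x - (1 / L) *\<^sub>R G)))\<^sup>2 + \<rho> / 2 * (norm1 (x - x))\<^sup>2"
    using min x unfolding is_arg_min_def by (meson not_le)
  moreover have "v - (x - (1 / L) *\<^sub>R G) = \<Delta> + (1 / L) *\<^sub>R G" "x - (x - (1 / L) *\<^sub>R G) = (1 / L) *\<^sub>R G"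
    by (simp_all add: \<Delta>_def)
  ultimately have "1 / 2 * (norm (\<Delta> + (1 / L) *\<^sub>R G))\<^sup>2 + \<rho> / 2 * (norm1 \<Delta>)\<^sup>2
      \<le> 1 / 2 * (norm ((1 / L) *\<^sub>R G))\<^sup>2"
    by (simp only: \<Delta>_def) simp
  moreover have "(norm (\<Delta> + (1 / L) *\<^sub>R G))\<^sup>2 = (norm \<Delta>)\<^sup>2 + 2 * (1 / L * (G \<bullet> \<Delta>)) + (norm ((1 / L) *\<^sub>R G))\<^sup>2"
    
    unfolding power2_norm_eq_inner by (simp add: inner_simps inner_commute)
  moreover define W where "W = 1 / L * (G \<bullet> \<Delta>) + \<rho> / 2 * (norm1 \<Delta>)\<^sup>2"
  ultimately have "(norm \<Delta>)\<^sup>2 + 2 * W \<le> 0"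
    by linarith
  then have "W \<le> 0"
    using zero_le_power2[of "norm \<Delta>"] by linarith
  then have "L * W \<le> 0"
    using L by (intro mult_nonneg_nonpos) auto
  then have G: "G \<bullet> \<Delta> \<le> - (\<rho> * L / 2) * (norm1 \<Delta>)\<^sup>2"
    using L by (simp add: W_def algebra_simps)
  have "- (e \<bullet> \<Delta>) \<le> infnorm e * norm1 \<Delta>"
    using abs_inner_le_infnorm_norm1[of e \<Delta>] by linarith
  also have "\<dots> \<le> \<rho> * L / 4 * (norm1 \<Delta>)\<^sup>2 + 1 / (\<rho> * L) * (infnorm e)\<^sup>2"
  proof -
    \<comment> \<open>Young's inequality as a completed square, weighted so as to spend exactly half
      of the gain.\<close>
    have "0 \<le> (\<rho> * L / 2 * norm1 \<Delta> - infnorm e)\<^sup>2 / (\<rho> * L)" using L \<rho> by simp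
    also have "\<dots> = \<rho> * L / 4 * (norm1 \<Delta>)\<^sup>2 + 1 / (\<rho> * L) * (infnorm e)\<^sup>2 - infnorm e * norm1 \<Delta>"
      using L \<rho> by (simp add: power2_diff field_simps power2_eq_square)
    finally show ?thesis by simp
  qed
  finally have e: "grad ?f x \<bullet> \<Delta> \<le> G \<bullet> \<Delta> + \<rho> * L / 4 * (norm1 \<Delta>)\<^sup>2 + 1 / (\<rho> * L) * (infnorm e)\<^sup>2"
    by (simp add: e_def inner_diff_left)
  have "?f v \<le> ?f x + grad ?f x \<bullet> \<Delta> + L / 2 * (norm1 \<Delta>)\<^sup>2"
    unfolding \<Delta>_def using objective_differentiable grad_objective_lipschitz convex_X x v
    by (intro smooth_quadratic_upper_bound[where X = X]) auto
  with e G show ?thesis by (simp add: \<Delta>_def e_def algebra_simps)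
qed

text \<open>The first-order condition is multiplied by \<open>L\<close>, and \<open>G\<close> is
  replaced by the gradient at the new point. The factor \<open>\<rho> + 2\<close> collects
  \<open>\<rho>\<close> from the proximal term, 1 from the Euclidean term and 1 from the change of
  the gradient.\<close>

lemma prox_step_stationarity:
  fixes x v G :: "real ^ 'n"
  assumes L: "0 < L" and \<rho>: "0 < \<rho>" and x: "x \<in> X" and y: "y \<in> X"
    and min: "is_arg_min (\<lambda>y. 1 / 2 * (norm (y - (x - (1 / L) *\<^sub>R G)))\<^sup>2 + \<rho> / 2 * (norm1 (y - x))\<^sup>2) (\<lambda>y. y \<in> X) v"
  shows "0 \<le> grad (objective D F) v \<bullet> (y - v)
    + ((\<rho> + 2) * L * norm1 (v - x) + infnorm (G - grad (objective D F) x)) * norm1 (y - v)"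
proof -
  let ?f = "objective D F"
  define \<Delta> where "\<Delta> = v - x"
  define e where "e = G - grad ?f x"
  define u where "u = y - v"
  have v: "v \<in> X" using min by (simp add: is_arg_min_def)
  have "0 \<le> (\<Delta> + (1 / L) *\<^sub>R G) \<bullet> u + \<rho> * norm1 \<Delta> * norm1 u"
    unfolding \<Delta>_def u_def using convex_X y \<rho> min by (intro prox_first_order) auto
  then have "0 \<le> L * ((\<Delta> + (1 / L) *\<^sub>R G) \<bullet> u + \<rho> * norm1 \<Delta> * norm1 u)"
    using L by simp
  then have 1: "0 \<le> L * (\<Delta> \<bullet> u) + G \<bullet> u + \<rho> * L * norm1 \<Delta> * norm1 u"
    using L by (simp add: algebra_simps inner_add_left)
  have "\<Delta> \<bullet> u \<le> norm1 \<Delta> * norm1 u"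
    using abs_inner_le_infnorm_norm1[of \<Delta> u] mult_right_mono[OF infnorm_le_norm1[of \<Delta>], of "norm1 u"] by simp
  then have 2: "L * (\<Delta> \<bullet> u) \<le> L * norm1 \<Delta> * norm1 u"
    using L by (simp add: mult.assoc)
  have 3: "e \<bullet> u \<le> infnorm e * norm1 u"
    using abs_inner_le_infnorm_norm1[of e u] by simp
  have 4: "- ((grad ?f v - grad ?f x) \<bullet> u) \<le> L * norm1 \<Delta> * norm1 u"
    using abs_inner_le_infnorm_norm1[of "grad ?f v - grad ?f x" u]
      mult_right_mono[OF grad_objective_lipschitz[OF v x], of "norm1 u"] by (simp add: \<Delta>_def)
  show ?thesis
    using 1 2 3 4 by (simp add: e_def inner_diff_left algebra_simps flip: \<Delta>_def u_def)
qed

end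

section \<open>Restarted recursions\<close>

lemma restart_Suc_iff:
  assumes "1 \<le> q0"
  shows "restart q0 (Suc k) \<longleftrightarrow> k mod q0 = 0"
proof (cases "q0 = 1")
  case False
  then have "1 mod q0 = 1" using assms by simp
  then show ?thesis using assms False by (auto simp: restart_def mod_Suc)
qed (simp add: restart_def)

text \<open>The weight of \<open>w (Suc N)\<close> counts the iterations before the next restart, each of which
  inherits the accumulated error.\<close>

lemma sum_restarted_recursion_le:
  fixes a d :: "nat \<Rightarrow> real"
  assumes q0: "1 \<le> q0" and c: "0 \<le> c" and d: "\<And>k. 0 \<le> d k"
    and restart: "\<And>k. k \<in> {1..K} \<Longrightarrow> restart q0 k \<Longrightarrow> a k \<le> s"
    and step: "\<And>k. k \<in> {1..K} \<Longrightarrow> \<not> restart q0 k \<Longrightarrow> a k \<le> a (k - 1) + c * d (k - 1)"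
  shows "(\<Sum>k=1..K. a k) \<le> real K * s + real q0 * c * (\<Sum>k=1..K. d k)"
proof -
  \<comment> \<open>The increments accumulated since the last restart, so that
    \<open>a k \<le> s + w k\<close>.\<close>
  define w where "w = rec_nat 0 (\<lambda>k v. if restart q0 (Suc k) then 0 else v + c * d k)"
  have w0: "w 0 = 0" and wS: "w (Suc k) = (if restart q0 (Suc k) then 0 else w k + c * d k)" for k
    by (simp_all add: w_def)
  have w: "0 \<le> w k" for k
    by (induction k) (use c d in \<open>auto simp: w0 wS\<close>)
  have a: "a (Suc k) \<le> s + w (Suc k)" if "Suc k \<le> K" for k
    using that
  proof (induction k)
    case 0
    then show ?case
      using restart[of 1] restart_Suc_iff[OF q0, of 0] by (simp add: wS)
  next
    case (Suc k)
    then show ?case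
      using restart[of "Suc (Suc k)"] step[of "Suc (Suc k)"] by (auto simp: wS[of "Suc k"])
  qed
  have sum_w: "(\<Sum>k=1..Suc N. w k) + (real q0 - 1 - real (N mod q0)) * w (Suc N)
      \<le> real q0 * c * (\<Sum>k=1..N. d k)" for N
  proof (induction N)
    case 0
    then show ?case using restart_Suc_iff[OF q0, of 0] by (simp add: wS)
  next
    case (Suc N)
    have r: "real (N mod q0) \<le> real q0 - 1"
      using q0 mod_less_divisor[of q0 N] by (simp add: of_nat_diff[symmetric] del: mod_less_divisor)
    show ?case
    proof (cases "restart q0 (Suc (Suc N))")
      case True
      have "(\<Sum>k=1..Suc N. w k) \<le> (\<Sum>k=1..Suc N. w k) + (real q0 - 1 - real (N mod q0)) * w (Suc N)"
        using w r by simp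
      also have "\<dots> \<le> real q0 * c * (\<Sum>k=1..N. d k)" by (rule Suc.IH)
      also have "\<dots> \<le> real q0 * c * (\<Sum>k=1..Suc N. d k)"
        using c d by (intro mult_left_mono) auto
      finally show ?thesis using True by (simp add: wS[of "Suc N"])
    next
      case False
      then have "Suc N mod q0 = Suc (N mod q0)"
        using restart_Suc_iff[OF q0, of "Suc N"] by (auto simp: mod_Suc split: if_splits)
      \<comment> \<open>The slack of the induction: the new increment is charged \<open>q0\<close>
        times, but only \<open>q0 - 1 - N mod q0\<close> iterations of the interval inherit
        it.\<close>
      moreover have "0 \<le> c * d (Suc N) + c * (d (Suc N) * real (N mod q0))"
        using c d by simp
      ultimately show ?thesis
        using Suc.IH False by (simp add: wS[of "Suc N"] algebra_simps)
    qed
  qed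
  have "(\<Sum>k=1..K. w k) \<le> real q0 * c * (\<Sum>k=1..K. d k)"
  proof (cases K)
    case (Suc N)
    have r: "real (N mod q0) \<le> real q0 - 1"
      using q0 mod_less_divisor[of q0 N] by (simp add: of_nat_diff[symmetric] del: mod_less_divisor)
    have "(\<Sum>k=1..Suc N. w k) \<le> (\<Sum>k=1..Suc N. w k) + (real q0 - 1 - real (N mod q0)) * w (Suc N)"
      using w r by simp
    also have "\<dots> \<le> real q0 * c * (\<Sum>k=1..N. d k)" by (rule sum_w)
    also have "\<dots> \<le> real q0 * c * (\<Sum>k=1..Suc N. d k)"
      using c d by (intro mult_left_mono) auto
    finally show ?thesis by (simp only: Suc)
  qed simp
  moreover have "(\<Sum>k=1..K. a k) \<le> (\<Sum>k=1..K. s + w k)"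
  proof (intro sum_mono)
    fix k assume "k \<in> {1..K}"
    then show "a k \<le> s + w k" using a[of "k - 1"] by (cases k) auto
  qed
  ultimately show ?thesis by (simp add: sum.distrib)
qed

text \<open>The sums cannot be rearranged while terms may be infinite. Finiteness starts from
  \<open>Fs 1\<close> and the first restart and spreads along the run: a finite right side of the
  descent inequality makes \<open>Ds k\<close> finite, as \<open>\<alpha> > 0\<close>, and
  \<open>Fs (Suc k)\<close> as well; then \<open>Es (Suc k)\<close> is finite. Afterwards the real
  inequalities are summed and telescoped.\<close>

lemma ennreal_recursion_real:
  fixes Fs Es Ds :: "nat \<Rightarrow> ennreal"
  assumes q0: "1 \<le> q0" and K: "1 \<le> K"
    and pos: "0 < \<alpha>" "0 \<le> \<beta>" "0 \<le> c" "0 \<le> s" "0 \<le> \<Delta>"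
    and F1: "Fs 1 = ennreal \<Delta>"
    and descent: "\<And>k. k \<in> {1..K} \<Longrightarrow> Fs (Suc k) + ennreal \<alpha> * Ds k \<le> Fs k + ennreal \<beta> * Es k"
    and restart: "\<And>k. k \<in> {1..K} \<Longrightarrow> restart q0 k \<Longrightarrow> Es k \<le> ennreal s"
    and step: "\<And>k. k \<in> {1..K} \<Longrightarrow> \<not> restart q0 k \<Longrightarrow> Es k \<le> Es (k - 1) + ennreal c * Ds (k - 1)"
  obtains d e where "\<And>k. 0 \<le> d k" "\<And>k. 0 \<le> e k"
    "\<And>k. k \<in> {1..K} \<Longrightarrow> Ds k = ennreal (d k)" "\<And>k. k \<in> {1..K} \<Longrightarrow> Es k = ennreal (e k)"
    "(\<Sum>k=1..K. e k) \<le> real K * s + real q0 * c * (\<Sum>k=1..K. d k)"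
    "\<alpha> * (\<Sum>k=1..K. d k) \<le> \<Delta> + \<beta> * (\<Sum>k=1..K. e k)"
proof
  define d where "d k = enn2real (Ds k)" for k
  define e where "e k = enn2real (Es k)" for k
  define \<phi> where "\<phi> k = enn2real (Fs k)" for k
  have r1: "restart q0 (Suc 0)" using restart_Suc_iff[OF q0, of 0] by simp
  have fin_step: "Ds k < \<infinity> \<and> Fs (Suc k) < \<infinity>" if "k \<in> {1..K}" "Fs k < \<infinity>" "Es k < \<infinity>" for k
  proof -
    have "Fs k + ennreal \<beta> * Es k < \<infinity>"
      using that by (simp add: ennreal_mult_less_top)
    then have "Fs (Suc k) + ennreal \<alpha> * Ds k < \<infinity>"
      using descent[OF that(1)] by (rule order.strict_trans1[rotated])
    then show ?thesis using pos by (auto simp: ennreal_mult_less_top)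
  qed
  have fin: "Fs (Suc k) < \<infinity> \<and> Es (Suc k) < \<infinity>" if "Suc k \<le> K" for k
    using that
  proof (induction k)
    case 0
    have "Es 1 < \<infinity>"
      using restart[of 1] r1 K by (auto intro: order.strict_trans1)
    then show ?case using F1 by simp
  next
    case (Suc k)
    then have "Ds (Suc k) < \<infinity>" "Fs (Suc (Suc k)) < \<infinity>" "Es (Suc k) < \<infinity>"
      using fin_step[of "Suc k"] by auto
    moreover have "Es (Suc (Suc k)) < \<infinity>"
    proof (cases "restart q0 (Suc (Suc k))")
      case True
      then show ?thesis using restart[of "Suc (Suc k)"] Suc.prems by (auto intro: order.strict_trans1)
    next
      case False
      then have "Es (Suc (Suc k)) \<le> Es (Suc k) + ennreal c * Ds (Suc k)"
        using step[of "Suc (Suc k)"] Suc.prems by simp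
      also have "\<dots> < \<infinity>"
        using calculation \<open>Ds (Suc k) < \<infinity>\<close> \<open>Es (Suc k) < \<infinity>\<close> by (simp add: ennreal_mult_less_top)
      finally show ?thesis .
    qed
    ultimately show ?case by simp
  qed
  have fin: "Fs k < \<infinity>" "Es k < \<infinity>" "Ds k < \<infinity>" "Fs (Suc k) < \<infinity>" if "k \<in> {1..K}" for k
  proof -
    show "Fs k < \<infinity>" "Es k < \<infinity>" using fin[of "k - 1"] that by auto
    then show "Ds k < \<infinity>" "Fs (Suc k) < \<infinity>" using fin_step that by auto
  qed
  show nonneg: "0 \<le> d k" "0 \<le> e k" for k by (simp_all add: d_def e_def)
  show De: "Ds k = ennreal (d k)" and Ee: "Es k = ennreal (e k)" if "k \<in> {1..K}" for k
    using fin[OF that] by (simp_all add: d_def e_def)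
  have Fe: "Fs k = ennreal (\<phi> k)" if "k \<in> {1..Suc K}" for k
    using fin[of k] fin(4)[of "k - 1"] that K by (cases "k = Suc K") (auto simp: \<phi>_def)
  have \<phi>: "0 \<le> \<phi> k" for k by (simp add: \<phi>_def)
  show "(\<Sum>k=1..K. e k) \<le> real K * s + real q0 * c * (\<Sum>k=1..K. d k)"
  proof (rule sum_restarted_recursion_le[OF q0])
    show "e k \<le> s" if "k \<in> {1..K}" "restart q0 k" for k
      using restart[OF that] Ee[OF that(1)] pos by (simp add: ennreal_le_iff)
    show "e k \<le> e (k - 1) + c * d (k - 1)" if k: "k \<in> {1..K}" "\<not> restart q0 k" for k
    proof -
      have "k \<noteq> 1" using k r1 by auto
      then have "k - 1 \<in> {1..K}" using k by auto
      then have "ennreal (e k) \<le> ennreal (e (k - 1) + c * d (k - 1))"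
        using step[OF k] De Ee k nonneg pos by (simp add: ennreal_plus ennreal_mult)
      then show ?thesis by (subst (asm) ennreal_le_iff) (simp_all add: nonneg pos)
    qed
  qed (use pos nonneg in auto)
  have desc: "\<phi> (Suc k) + \<alpha> * d k \<le> \<phi> k + \<beta> * e k" if k: "k \<in> {1..K}" for k
  proof -
    have "ennreal (\<phi> (Suc k) + \<alpha> * d k) \<le> ennreal (\<phi> k + \<beta> * e k)"
      using descent[OF k] De[OF k] Ee[OF k] Fe[of k] Fe[of "Suc k"] k nonneg pos \<phi>
      by (simp add: ennreal_plus ennreal_mult)
    then show ?thesis by (subst (asm) ennreal_le_iff) (simp_all add: nonneg pos \<phi> less_imp_le)
  qed
  have "\<phi> (Suc n) + \<alpha> * (\<Sum>k=1..n. d k) \<le> \<phi> 1 + \<beta> * (\<Sum>k=1..n. e k)" if "n \<le> K" for n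
    using that
  proof (induction n)
    case (Suc n)
    then show ?case using desc[of "Suc n"] by (simp add: algebra_simps)
  qed simp
  moreover have "\<phi> 1 = \<Delta>" unfolding \<phi>_def F1 using pos by simp
  ultimately show "\<alpha> * (\<Sum>k=1..K. d k) \<le> \<Delta> + \<beta> * (\<Sum>k=1..K. e k)"
    using \<phi>[of "Suc K"] by fastforce
qed

text \<open>Each iteration is charged \<open>m\<close> and each restart another \<open>m1\<close>.
  Restarts are the \<open>k\<close> with \<open>k - 1\<close> divisible by \<open>q0\<close>, so
  \<open>(k - 1) div q0\<close> numbers them injectively.\<close>

lemma sample_complexity_le:
  assumes q0: "1 \<le> q0"
  shows "sample_complexity q0 m1 m K \<le> K * m + nat \<lceil>real K / real q0\<rceil> * m1"
proof -
  let ?R = "{k \<in> {1..K}. restart q0 k}"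
  have "sample_complexity q0 m1 m K \<le> (\<Sum>k=1..K. m + (if restart q0 k then m1 else 0))"
    unfolding sample_complexity_def batch_def by (intro sum_mono) auto
  also have "\<dots> = K * m + card ?R * m1"
    by (simp add: sum.distrib sum.If_cases Int_def)
  also have "card ?R \<le> card {0..<nat \<lceil>real K / real q0\<rceil>}"
  proof (rule card_inj_on_le[where f = "\<lambda>k. (k - 1) div q0"])
    have *: "k = Suc ((k - 1) div q0 * q0)" if "k \<in> ?R" for k
    proof -
      have k: "k = Suc (k - 1)" using that by auto
      then have "(k - 1) mod q0 = 0"
        using restart_Suc_iff[OF q0, of "k - 1"] that by auto
      then show ?thesis
        using k div_mult_mod_eq[of "k - 1" q0] by simp
    qed
    show "inj_on (\<lambda>k. (k - 1) div q0) ?R"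
      by (rule inj_onI) (use * in metis)
    show "(\<lambda>k. (k - 1) div q0) ` ?R \<subseteq> {0..<nat \<lceil>real K / real q0\<rceil>}"
    proof (rule image_subsetI)
      fix k assume k: "k \<in> ?R"
      have "(k - 1) div q0 * q0 < K" using *[OF k] k by auto
      then have "real ((k - 1) div q0) * real q0 < real K"
        by (metis of_nat_less_iff of_nat_mult)
      then have "real ((k - 1) div q0) < real K / real q0"
        using q0 by (simp add: pos_less_divide_eq)
      then show "(k - 1) div q0 \<in> {0..<nat \<lceil>real K / real q0\<rceil>}"
        by (simp only: atLeastLessThan_iff) linarith
    qed
  qed simp
  finally show ?thesis by simp
qed

section \<open>Expected errors along a run\<close>

text \<open>The potential stays abstract, since only its measurability, its value at 0, its
  domination of \<open>infnorm\<^sup>2\<close> and its smoothness matter for the run. The condition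
  \<open>2 < \<rho>\<close> makes the descent coefficient positive.\<close>

locale vr_run = problem: stochastic_problem D F X L f_low +
  variance_reduced_method M D F X "\<lambda>z. \<rho> / 2 * (norm1 z)\<^sup>2" "\<lambda>_. 1 / L" "\<lambda>_. 1 / real K"
    q0 m1 m K x G \<zeta> Y
  for D :: "'z measure" and M :: "'w measure" and F :: "real ^ 'n \<Rightarrow> 'z \<Rightarrow> real"
    and X L f_low \<rho> q0 m1 m K x G \<zeta> Y +
  fixes \<Phi> :: "real ^ 'n \<Rightarrow> real" and C :: real
  assumes \<rho>: "2 < \<rho>"
    and C: "0 \<le> C"
    and \<Phi>_measurable [measurable]: "\<Phi> \<in> borel_measurable borel"
    and \<Phi>_0: "\<Phi> 0 = 0"
    and infnorm_le_\<Phi>: "\<And>v. (infnorm v)\<^sup>2 \<le> \<Phi> v"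
    and \<Phi>_smooth: "\<And>a. \<exists>g. \<forall>y. \<Phi> (a + y) \<le> \<Phi> a + g \<bullet> y + C * (infnorm y)\<^sup>2"
begin

abbreviation f where "f \<equiv> objective D F"

abbreviation err where "err k \<omega> \<equiv> G k \<omega> - grad f (x k \<omega>)"

text \<open>As \<open>1 / 0 = 0\<close>, a positive stepsize \<open>1 / L\<close> excludes
  \<open>L = 0\<close>.\<close>

lemma L_pos: "0 < L"
  using stepsize_pos[of 1] counts_pos by simp

lemma \<Phi>_nonneg: "0 \<le> \<Phi> v"
  using infnorm_le_\<Phi>[of v] by (rule order.trans[OF zero_le_power2])

lemma x_in_X: "\<omega> \<in> space M \<Longrightarrow> k \<in> {1..Suc K} \<Longrightarrow> x k \<omega> \<in> X"
proof (cases "k = 1")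
  case False
  assume \<omega>: "\<omega> \<in> space M" and "k \<in> {1..Suc K}"
  then have "k - 1 \<in> {1..K}" "k = k - 1 + 1" using False by auto
  then show ?thesis
    using proximal_step[OF _ \<omega>, of "k - 1"] unfolding is_arg_min_def by metis
qed (simp add: start[unfolded One_nat_def])

text \<open>The independence of the output index is the place where all \<open>K + 1\<close>
  iterates appear; the histories stop at \<open>x K\<close>.\<close>

lemma x_measurable: "k \<in> {1..Suc K} \<Longrightarrow> x k \<in> borel_measurable M"
proof -
  assume k: "k \<in> {1..Suc K}"
  have "(\<lambda>\<omega>. \<lambda>k\<in>{1..K + 1}. x k \<omega>) \<in> measurable M (\<Pi>\<^sub>M k\<in>{1..K + 1}. borel)"
    using index_indep by (simp add: indep_rvs_def)
  from measurable_compose[OF this measurable_component_singleton[of k]] k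
  show ?thesis by simp
qed

lemma distr_batch:
  assumes k: "k \<in> {1..K}"
  shows "distr M (\<Pi>\<^sub>M i\<in>{1..batch q0 m1 m k}. D) (\<lambda>\<omega>. \<lambda>i\<in>{1..batch q0 m1 m k}. \<zeta> k i \<omega>)
    = (\<Pi>\<^sub>M i\<in>{1..batch q0 m1 m k}. D)"
proof -
  let ?I = "{1..batch q0 m1 m k}"
  have "?I \<noteq> {}" using counts_pos by (simp add: batch_def)
  then have "distr M (Pi\<^sub>M ?I (\<lambda>_. D)) (\<lambda>\<omega>. \<lambda>i\<in>?I. \<zeta> k i \<omega>) = Pi\<^sub>M ?I (\<lambda>i. distr M D (\<zeta> k i))"
    using indep_vars_iff_distr_eq_PiM'[where I = ?I and M' = "\<lambda>_. D" and X = "\<zeta> k"] batch_indep[OF k] sample_law[OF k] by blast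
  also have "\<dots> = Pi\<^sub>M ?I (\<lambda>_. D)"
    using sample_law[OF k] by (intro PiM_cong) auto
  finally show ?thesis .
qed

abbreviation history_space where
  "history_space k \<equiv> (\<Pi>\<^sub>M j\<in>{1..k}. borel :: (real ^ 'n) measure) \<Otimes>\<^sub>M (\<Pi>\<^sub>M j\<in>{1..<k}. borel :: (real ^ 'n) measure)"

abbreviation history where
  "history k \<omega> \<equiv> (\<lambda>j\<in>{1..k}. x j \<omega>, \<lambda>j\<in>{1..<k}. G j \<omega>)"

text \<open>Conditionally on the history, the summands are independent and centred.\<close>

lemma nn_integral_batch_potential:
  fixes a :: "(nat \<Rightarrow> real ^ 'n) \<times> (nat \<Rightarrow> real ^ 'n) \<Rightarrow> real ^ 'n"
    and \<psi> :: "(nat \<Rightarrow> real ^ 'n) \<times> (nat \<Rightarrow> real ^ 'n) \<Rightarrow> 'z \<Rightarrow> real ^ 'n"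
  assumes k: "k \<in> {1..K}"
    and a [measurable]: "a \<in> borel_measurable (history_space k)"
    and \<psi> [measurable]: "(\<lambda>(h, z). \<psi> h z) \<in> borel_measurable (history_space k \<Otimes>\<^sub>M D)"
    and centred: "\<And>\<omega>. \<omega> \<in> space M \<Longrightarrow> has_bochner_integral D (\<psi> (history k \<omega>)) 0"
    and second: "\<And>\<omega>. \<omega> \<in> space M \<Longrightarrow>
      (\<integral>\<^sup>+z. ennreal ((infnorm (\<psi> (history k \<omega>) z))\<^sup>2) \<partial>D) \<le> ennreal (B \<omega>)"
    and B [measurable]: "B \<in> borel_measurable M"
  shows "(\<integral>\<^sup>+\<omega>. ennreal (\<Phi> (a (history k \<omega>) + (\<Sum>i=1..batch q0 m1 m k. \<psi> (history k \<omega>) (\<zeta> k i \<omega>)))) \<partial>M)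
    \<le> (\<integral>\<^sup>+\<omega>. ennreal (\<Phi> (a (history k \<omega>))) \<partial>M)
      + of_nat (batch q0 m1 m k) * (ennreal C * (\<integral>\<^sup>+\<omega>. ennreal (B \<omega>) \<partial>M))"
proof -
  let ?I = "{1..batch q0 m1 m k}"
  let ?S = "history_space k" and ?T = "\<Pi>\<^sub>M i\<in>?I. D" and ?U = "history k"
  let ?V = "\<lambda>\<omega>. \<lambda>i\<in>?I. \<zeta> k i \<omega>"
  let ?g = "\<lambda>(h, zs). ennreal (\<Phi> (a h + (\<Sum>i\<in>?I. \<psi> h (zs i))))"
  have indep: "indep_rvs M ?S ?U ?T ?V" by (rule history_indep[OF k])
  then have U [measurable]: "?U \<in> measurable M ?S" by (simp add: indep_rvs_def)
  have \<psi>' [measurable]: "(\<lambda>w. \<psi> (fst w) (snd w i)) \<in> borel_measurable (?S \<Otimes>\<^sub>M ?T)" if "i \<in> ?I" for i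
  proof -
    have "(\<lambda>w. (fst w, snd w i)) \<in> measurable (?S \<Otimes>\<^sub>M ?T) (?S \<Otimes>\<^sub>M D)"
      using that by measurable
    from measurable_compose[OF this \<psi>] show ?thesis by simp
  qed
  have g: "?g \<in> borel_measurable (?S \<Otimes>\<^sub>M ?T)"
    unfolding case_prod_beta by measurable
  have "(\<integral>\<^sup>+\<omega>. ennreal (\<Phi> (a (?U \<omega>) + (\<Sum>i\<in>?I. \<psi> (?U \<omega>) (\<zeta> k i \<omega>)))) \<partial>M)
      = (\<integral>\<^sup>+\<omega>. ?g (?U \<omega>, ?V \<omega>) \<partial>M)"
    by (auto intro!: nn_integral_cong sum.cong arg_cong[where f = \<Phi>] arg_cong[where f = ennreal])
  also have "\<dots> = (\<integral>\<^sup>+\<omega>. (\<integral>\<^sup>+v. ?g (?U \<omega>, v) \<partial>distr M ?T ?V) \<partial>M)"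
    by (rule nn_integral_indep_rvs[OF indep g])
  also have "\<dots> = (\<integral>\<^sup>+\<omega>. (\<integral>\<^sup>+v. ennreal (\<Phi> (a (?U \<omega>) + (\<Sum>i\<in>?I. \<psi> (?U \<omega>) (v i)))) \<partial>?T) \<partial>M)"
    unfolding distr_batch[OF k] by simp
  also have "\<dots> \<le> (\<integral>\<^sup>+\<omega>. ennreal (\<Phi> (a (?U \<omega>))) + of_nat (batch q0 m1 m k) * (ennreal C * ennreal (B \<omega>)) \<partial>M)"
  proof (rule nn_integral_mono)
    fix \<omega> assume \<omega>: "\<omega> \<in> space M"
    have "(\<integral>\<^sup>+v. ennreal (\<Phi> (a (?U \<omega>) + (\<Sum>i\<in>?I. \<psi> (?U \<omega>) (v i)))) \<partial>?T)
        \<le> ennreal (\<Phi> (a (?U \<omega>)))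
          + of_nat (card ?I) * (ennreal C * (\<integral>\<^sup>+z. ennreal ((infnorm (\<psi> (?U \<omega>) z))\<^sup>2) \<partial>D))"
      by (rule problem.nn_integral_potential_sum[OF _ centred[OF \<omega>] \<Phi>_measurable \<Phi>_nonneg C \<Phi>_smooth]) simp
    also have "\<dots> \<le> ennreal (\<Phi> (a (?U \<omega>))) + of_nat (card ?I) * (ennreal C * ennreal (B \<omega>))"
      by (intro add_left_mono mult_left_mono second[OF \<omega>]) auto
    finally show "(\<integral>\<^sup>+v. ennreal (\<Phi> (a (?U \<omega>) + (\<Sum>i\<in>?I. \<psi> (?U \<omega>) (v i)))) \<partial>?T)
        \<le> ennreal (\<Phi> (a (?U \<omega>))) + of_nat (batch q0 m1 m k) * (ennreal C * ennreal (B \<omega>))"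
      by simp
  qed
  also have "\<dots> = (\<integral>\<^sup>+\<omega>. ennreal (\<Phi> (a (?U \<omega>))) \<partial>M)
      + of_nat (batch q0 m1 m k) * (ennreal C * (\<integral>\<^sup>+\<omega>. ennreal (B \<omega>) \<partial>M))"
    using measurable_compose[OF U a] by (subst nn_integral_add) (measurable, simp_all add: nn_integral_cmult)
  finally show ?thesis .
qed

lemma borel_measurable_history_x:
  assumes "j \<in> {1..k}"
  shows "(\<lambda>h. fst h j) \<in> borel_measurable (history_space k)"
  using assms by (intro measurable_compose[OF measurable_fst] measurable_component_singleton)

lemma borel_measurable_history_stoch_grad:
  assumes "j \<in> {1..k}"
  shows "(\<lambda>(h, z). stoch_grad F (fst h j) z) \<in> borel_measurable (history_space k \<Otimes>\<^sub>M D)"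
proof -
  note [measurable] = borel_measurable_history_x[OF assms]
  have "(\<lambda>w. (fst (fst w) j, snd w)) \<in> measurable (history_space k \<Otimes>\<^sub>M D) (borel \<Otimes>\<^sub>M D)"
    by measurable
  from measurable_compose[OF this problem.stoch_grad_measurable] show ?thesis
    by (simp add: case_prod_beta')
qed

lemma borel_measurable_history_grad:
  assumes "j \<in> {1..k}"
  shows "(\<lambda>h. grad f (fst h j)) \<in> borel_measurable (history_space k)"
  by (rule measurable_compose[OF borel_measurable_history_x[OF assms] problem.grad_objective_measurable])

text \<open>The error is a sum of \<open>m1\<close> centred vectors scaled by \<open>1 / m1\<close>,
  started from 0; each contributes at most \<open>C * \<sigma>\<^sup>2 / m1\<^sup>2\<close>, where
  \<open>\<sigma>\<close> is the noise level.\<close>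

lemma err_potential_restart:
  assumes k: "k \<in> {1..K}" and rs: "restart q0 k"
  shows "(\<integral>\<^sup>+\<omega>. ennreal (\<Phi> (err k \<omega>)) \<partial>M) \<le> ennreal (C * (sigma_inf D F X)\<^sup>2 / real m1)"
proof -
  let ?b = "batch q0 m1 m k"
  have b: "?b = m1" using rs by (simp add: batch_def)
  have m1: "real m1 > 0" using counts_pos by simp
  let ?\<sigma>2 = "(sigma_inf D F X)\<^sup>2"
  define \<psi> where "\<psi> h z = (1 / real m1) *\<^sub>R (stoch_grad F (fst h k) z - grad f (fst h k))" for h :: "(nat \<Rightarrow> real ^ 'n) \<times> (nat \<Rightarrow> real ^ 'n)" and z
  have kk: "k \<in> {1..k}" using k by simp
  note [measurable] = borel_measurable_history_stoch_grad[OF kk] borel_measurable_history_grad[OF kk]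
  have *: "(\<Sum>i=1..?b. \<psi> (history k \<omega>) (\<zeta> k i \<omega>)) = err k \<omega>" if "\<omega> \<in> space M" for \<omega>
    using estimate_restart[OF k rs that] m1 k
    by (simp add: \<psi>_def b scaleR_sum_right[symmetric] sum_subtractf scaleR_diff_right sum_constant_scaleR del: sum_constant)
  have "(\<integral>\<^sup>+\<omega>. ennreal (\<Phi> (err k \<omega>)) \<partial>M)
      = (\<integral>\<^sup>+\<omega>. ennreal (\<Phi> (0 + (\<Sum>i=1..?b. \<psi> (history k \<omega>) (\<zeta> k i \<omega>)))) \<partial>M)"
    by (intro nn_integral_cong) (simp only: * add_0_left)
  also have "\<dots> \<le> (\<integral>\<^sup>+\<omega>. ennreal (\<Phi> 0) \<partial>M)
      + of_nat ?b * (ennreal C * (\<integral>\<^sup>+\<omega>. ennreal ((1 / real m1)\<^sup>2 * ?\<sigma>2) \<partial>M))"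
  proof (rule nn_integral_batch_potential[OF k, where a = "\<lambda>_. 0"])
    show "(\<lambda>(h, z). \<psi> h z) \<in> borel_measurable (history_space k \<Otimes>\<^sub>M D)"
      unfolding \<psi>_def by measurable
    fix \<omega> assume \<omega>: "\<omega> \<in> space M"
    have x: "x k \<omega> \<in> X" using x_in_X \<omega> k by simp
    have hist: "fst (history k \<omega>) k = x k \<omega>" using k by simp
    have "has_bochner_integral D (\<lambda>z. stoch_grad F (x k \<omega>) z - grad f (x k \<omega>)) (grad f (x k \<omega>) - grad f (x k \<omega>))"
      using problem.unbiased[OF x] by (simp add: has_bochner_integral_iff problem.prob_space)
    from has_bochner_integral_scaleR_right[OF this, of "1 / real m1"]
    show "has_bochner_integral D (\<psi> (history k \<omega>)) 0"
      unfolding \<psi>_def hist by simp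
    note [measurable] = borel_measurable_has_bochner_integral[OF problem.unbiased[OF x]]
    have "(\<integral>\<^sup>+z. ennreal ((infnorm (\<psi> (history k \<omega>) z))\<^sup>2) \<partial>D)
      = (\<integral>\<^sup>+z. ennreal ((1 / real m1)\<^sup>2) * ennreal ((infnorm (stoch_grad F (x k \<omega>) z - grad f (x k \<omega>)))\<^sup>2) \<partial>D)"
      by (simp only: \<psi>_def infnorm_mul power_mult_distrib power2_abs ennreal_mult zero_le_power2 hist)
    also have "\<dots> = ennreal ((1 / real m1)\<^sup>2)
        * (\<integral>\<^sup>+z. ennreal ((infnorm (stoch_grad F (x k \<omega>) z - grad f (x k \<omega>)))\<^sup>2) \<partial>D)"
      by (rule nn_integral_cmult) measurable
    also have "\<dots> \<le> ennreal ((1 / real m1)\<^sup>2) * ennreal ?\<sigma>2"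
      by (intro mult_left_mono problem.nn_integral_noise_le x) simp
    finally show "(\<integral>\<^sup>+z. ennreal ((infnorm (\<psi> (history k \<omega>) z))\<^sup>2) \<partial>D) \<le> ennreal ((1 / real m1)\<^sup>2 * ?\<sigma>2)"
      by (simp only: ennreal_mult zero_le_power2)
  qed simp_all
  also have "\<dots> = ennreal (C * ?\<sigma>2 / real m1)"
    using m1 C by (simp add: \<Phi>_0 b emeasure_space_1 ennreal_of_nat_eq_real_of_nat power2_eq_square flip: ennreal_mult)
  finally show ?thesis .
qed

lemma G_measurable_before:
  assumes k: "k \<in> {1..K}" and j: "j \<in> {1..<k}"
  shows "G j \<in> borel_measurable M"
proof -
  have "history k \<in> measurable M (history_space k)"
    using history_indep[OF k] by (simp add: indep_rvs_def)
  from measurable_compose[OF this measurable_snd]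
  have "(\<lambda>\<omega>. \<lambda>j\<in>{1..<k}. G j \<omega>) \<in> measurable M (\<Pi>\<^sub>M j\<in>{1..<k}. borel)" by simp
  from measurable_compose[OF this measurable_component_singleton[OF j]] j
  show ?thesis by simp
qed

text \<open>Histories contain estimates only up to the preceding iteration, so the last estimate is
  shown measurable through its defining formula.\<close>

lemma G_measurable:
  assumes k: "k \<in> {1..K}"
  shows "G k \<in> borel_measurable M"
proof -
  have sg: "(\<lambda>\<omega>. stoch_grad F (x j \<omega>) (\<zeta> k i \<omega>)) \<in> borel_measurable M"
    if "j \<in> {1..K}" "i \<in> {1..batch q0 m1 m k}" for i j
  proof -
    have [measurable]: "x j \<in> borel_measurable M" using x_measurable that by simp
    have [measurable]: "\<zeta> k i \<in> measurable M D" using sample_law[OF k] that by blast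
    have "(\<lambda>\<omega>. (x j \<omega>, \<zeta> k i \<omega>)) \<in> measurable M (borel \<Otimes>\<^sub>M D)" by measurable
    from measurable_compose[OF this problem.stoch_grad_measurable] show ?thesis by simp
  qed
  show ?thesis
  proof (cases "restart q0 k")
    case True
    show ?thesis
      by (subst measurable_cong[OF estimate_restart[OF k True]], assumption)
         (intro borel_measurable_scaleR borel_measurable_sum borel_measurable_const sg k)
  next
    case False
    then have "k \<noteq> 1" using restart_Suc_iff[OF counts_pos(2), of 0] by auto
    then have k1: "k - 1 \<in> {1..<k}" "k - 1 \<in> {1..K}" using k by auto
    show ?thesis
      by (subst measurable_cong[OF estimate_recursive[OF k False]], assumption)
         (intro borel_measurable_add borel_measurable_diff borel_measurable_scaleR borel_measurable_sum
            borel_measurable_const sg k k1 G_measurable_before[OF k])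
  qed
qed

text \<open>The new error is the old one plus \<open>m\<close> centred differences scaled by
  \<open>1 / m\<close>. The old error is a function of the history, so independence of the fresh
  batch makes these differences a martingale increment.\<close>

lemma err_potential_step:
  assumes k: "k \<in> {1..K}" and rs: "\<not> restart q0 k"
  shows "(\<integral>\<^sup>+\<omega>. ennreal (\<Phi> (err k \<omega>)) \<partial>M) \<le> (\<integral>\<^sup>+\<omega>. ennreal (\<Phi> (err (k - 1) \<omega>)) \<partial>M)
    + ennreal (4 * C * L\<^sup>2 / real m) * (\<integral>\<^sup>+\<omega>. ennreal ((norm1 (x k \<omega> - x (k - 1) \<omega>))\<^sup>2) \<partial>M)"
proof -
  let ?b = "batch q0 m1 m k"
  have b: "?b = m" using rs by (simp add: batch_def)
  have m: "real m > 0" using counts_pos by simp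
  have "k \<noteq> 1" using rs restart_Suc_iff[OF counts_pos(2), of 0] by auto
  then have k1: "k - 1 \<in> {1..<k}" "k - 1 \<in> {1..k}" "k - 1 \<in> {1..Suc K}" using k by auto
  have kk: "k \<in> {1..k}" "k \<in> {1..Suc K}" using k by auto
  define \<psi> where "\<psi> h z = (1 / real m) *\<^sub>R (stoch_grad F (fst h k) z - stoch_grad F (fst h (k - 1)) z
    - (grad f (fst h k) - grad f (fst h (k - 1))))" for h :: "(nat \<Rightarrow> real ^ 'n) \<times> (nat \<Rightarrow> real ^ 'n)" and z
  \<comment> \<open>The previous error, read off from the history; \<open>k - 1 \<ge> 1\<close>
    because iteration 1 is a restart.\<close>
  define a where "a h = snd h (k - 1) - grad f (fst h (k - 1))" for h :: "(nat \<Rightarrow> real ^ 'n) \<times> (nat \<Rightarrow> real ^ 'n)"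
  let ?B = "\<lambda>\<omega>. (1 / real m)\<^sup>2 * (4 * L\<^sup>2 * (norm1 (x k \<omega> - x (k - 1) \<omega>))\<^sup>2)"
  note [measurable] = borel_measurable_history_stoch_grad[OF kk(1)] borel_measurable_history_grad[OF kk(1)]
    borel_measurable_history_stoch_grad[OF k1(2)] borel_measurable_history_grad[OF k1(2)]
    x_measurable[OF kk(2)] x_measurable[OF k1(3)]
  have hist: "fst (history k \<omega>) k = x k \<omega>" "fst (history k \<omega>) (k - 1) = x (k - 1) \<omega>"
    "snd (history k \<omega>) (k - 1) = G (k - 1) \<omega>" for \<omega>
    using k1 kk by auto
  have *: "a (history k \<omega>) + (\<Sum>i=1..?b. \<psi> (history k \<omega>) (\<zeta> k i \<omega>)) = err k \<omega>" if "\<omega> \<in> space M" for \<omega>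
  proof -
    have "(\<Sum>i=1..?b. \<psi> (history k \<omega>) (\<zeta> k i \<omega>)) = (1 / real m) *\<^sub>R
        ((\<Sum>i=1..?b. stoch_grad F (x k \<omega>) (\<zeta> k i \<omega>)) - (\<Sum>i=1..?b. stoch_grad F (x (k - 1) \<omega>) (\<zeta> k i \<omega>))
          - real m *\<^sub>R (grad f (x k \<omega>) - grad f (x (k - 1) \<omega>)))"
      unfolding \<psi>_def hist by (simp only: scaleR_sum_right[symmetric] sum_subtractf) (simp add: b sum_constant_scaleR algebra_simps del: sum_constant)
    moreover have "a (history k \<omega>) = G (k - 1) \<omega> - grad f (x (k - 1) \<omega>)"
      by (simp only: a_def hist)
    ultimately show ?thesis
      using estimate_recursive[OF k rs that] m by (simp add: b scaleR_diff_right)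
  qed
  have "(\<integral>\<^sup>+\<omega>. ennreal (\<Phi> (err k \<omega>)) \<partial>M)
      = (\<integral>\<^sup>+\<omega>. ennreal (\<Phi> (a (history k \<omega>) + (\<Sum>i=1..?b. \<psi> (history k \<omega>) (\<zeta> k i \<omega>)))) \<partial>M)"
    by (intro nn_integral_cong) (simp only: *)
  also have "\<dots> \<le> (\<integral>\<^sup>+\<omega>. ennreal (\<Phi> (a (history k \<omega>))) \<partial>M)
      + of_nat ?b * (ennreal C * (\<integral>\<^sup>+\<omega>. ennreal (?B \<omega>) \<partial>M))"
  proof (rule nn_integral_batch_potential[OF k])
    show "(\<lambda>(h, z). \<psi> h z) \<in> borel_measurable (history_space k \<Otimes>\<^sub>M D)"
      unfolding \<psi>_def by measurable
    show "a \<in> borel_measurable (history_space k)"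
      unfolding a_def using k1 by measurable
    show "?B \<in> borel_measurable M" by measurable
    fix \<omega> assume \<omega>: "\<omega> \<in> space M"
    have x: "x k \<omega> \<in> X" "x (k - 1) \<omega> \<in> X" using x_in_X \<omega> k1 kk by auto
    let ?\<xi> = "\<lambda>z. stoch_grad F (x k \<omega>) z - stoch_grad F (x (k - 1) \<omega>) z - (grad f (x k \<omega>) - grad f (x (k - 1) \<omega>))"
    have "has_bochner_integral D ?\<xi> (grad f (x k \<omega>) - grad f (x (k - 1) \<omega>) - (grad f (x k \<omega>) - grad f (x (k - 1) \<omega>)))"
      using problem.unbiased[OF x(1)] problem.unbiased[OF x(2)]
      by (simp add: has_bochner_integral_iff problem.prob_space)
    from has_bochner_integral_scaleR_right[OF this, of "1 / real m"]
    show "has_bochner_integral D (\<psi> (history k \<omega>)) 0"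
      unfolding \<psi>_def hist by simp
    note [measurable] = borel_measurable_has_bochner_integral[OF problem.unbiased[OF x(1)]]
      borel_measurable_has_bochner_integral[OF problem.unbiased[OF x(2)]]
    have "(\<integral>\<^sup>+z. ennreal ((infnorm (\<psi> (history k \<omega>) z))\<^sup>2) \<partial>D)
      = (\<integral>\<^sup>+z. ennreal ((1 / real m)\<^sup>2) * ennreal ((infnorm (?\<xi> z))\<^sup>2) \<partial>D)"
      by (simp only: \<psi>_def hist infnorm_mul power_mult_distrib power2_abs ennreal_mult zero_le_power2)
    also have "\<dots> = ennreal ((1 / real m)\<^sup>2) * (\<integral>\<^sup>+z. ennreal ((infnorm (?\<xi> z))\<^sup>2) \<partial>D)"
      by (rule nn_integral_cmult) measurable
    also have "\<dots> \<le> ennreal ((1 / real m)\<^sup>2) * ennreal (4 * L\<^sup>2 * (norm1 (x k \<omega> - x (k - 1) \<omega>))\<^sup>2)"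
      by (intro mult_left_mono problem.nn_integral_centred_diff_le x) simp
    also have "\<dots> = ennreal (?B \<omega>)"
      by (rule ennreal_mult[symmetric]) auto
    finally show "(\<integral>\<^sup>+z. ennreal ((infnorm (\<psi> (history k \<omega>) z))\<^sup>2) \<partial>D) \<le> ennreal (?B \<omega>)" .
  qed
  also have "(\<integral>\<^sup>+\<omega>. ennreal (\<Phi> (a (history k \<omega>))) \<partial>M) = (\<integral>\<^sup>+\<omega>. ennreal (\<Phi> (err (k - 1) \<omega>)) \<partial>M)"
    by (simp only: a_def hist)
  also have "of_nat ?b * (ennreal C * (\<integral>\<^sup>+\<omega>. ennreal (?B \<omega>) \<partial>M))
      = ennreal (4 * C * L\<^sup>2 / real m) * (\<integral>\<^sup>+\<omega>. ennreal ((norm1 (x k \<omega> - x (k - 1) \<omega>))\<^sup>2) \<partial>M)"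
  proof -
    have "(\<integral>\<^sup>+\<omega>. ennreal (?B \<omega>) \<partial>M)
        = ennreal ((1 / real m)\<^sup>2 * (4 * L\<^sup>2)) * (\<integral>\<^sup>+\<omega>. ennreal ((norm1 (x k \<omega> - x (k - 1) \<omega>))\<^sup>2) \<partial>M)"
      by (subst nn_integral_cmult[symmetric]) (measurable, simp add: mult.assoc flip: ennreal_mult)
    moreover have "of_nat ?b * (ennreal C * ennreal ((1 / real m)\<^sup>2 * (4 * L\<^sup>2))) = ennreal (4 * C * L\<^sup>2 / real m)"
      using m C by (simp add: b ennreal_of_nat_eq_real_of_nat power2_eq_square flip: ennreal_mult)
    ultimately show ?thesis by (simp only: mult.assoc[symmetric])
  qed
  finally show ?thesis .
qed

text \<open>Subtracting \<open>f_low\<close> makes the integrands nonnegative on \<open>X\<close>,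
  so the descent can be integrated before integrability of the objective along the run is
  known.\<close>

lemma objective_descent:
  assumes k: "k \<in> {1..K}"
  shows "(\<integral>\<^sup>+\<omega>. ennreal (f (x (Suc k) \<omega>) - f_low) \<partial>M)
      + ennreal ((\<rho> / 4 - 1 / 2) * L) * (\<integral>\<^sup>+\<omega>. ennreal ((norm1 (x (Suc k) \<omega> - x k \<omega>))\<^sup>2) \<partial>M)
    \<le> (\<integral>\<^sup>+\<omega>. ennreal (f (x k \<omega>) - f_low) \<partial>M)
      + ennreal (1 / (\<rho> * L)) * (\<integral>\<^sup>+\<omega>. ennreal (\<Phi> (err k \<omega>)) \<partial>M)"
proof -
  let ?\<alpha> = "(\<rho> / 4 - 1 / 2) * L" and ?\<beta> = "1 / (\<rho> * L)"
  have \<alpha>: "0 \<le> ?\<alpha>" and \<beta>: "0 \<le> ?\<beta>" using \<rho> L_pos by auto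
  have kk: "k \<in> {1..Suc K}" "Suc k \<in> {1..Suc K}" using k by auto
  note [measurable] = x_measurable[OF kk(1)] x_measurable[OF kk(2)] G_measurable[OF k] problem.grad_objective_measurable
  have [measurable]: "f \<in> borel_measurable borel"
    using problem.objective_differentiable
    by (intro borel_measurable_continuous_onI)
       (simp add: continuous_on_eq_continuous_within differentiable_imp_continuous_within)
  have "(\<integral>\<^sup>+\<omega>. ennreal (f (x (Suc k) \<omega>) - f_low) \<partial>M)
      + ennreal ?\<alpha> * (\<integral>\<^sup>+\<omega>. ennreal ((norm1 (x (Suc k) \<omega> - x k \<omega>))\<^sup>2) \<partial>M)
    = (\<integral>\<^sup>+\<omega>. ennreal (f (x (Suc k) \<omega>) - f_low) + ennreal ?\<alpha> * ennreal ((norm1 (x (Suc k) \<omega> - x k \<omega>))\<^sup>2) \<partial>M)"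
    by (subst nn_integral_add, measurable) (subst nn_integral_cmult, measurable)
  also have "\<dots> \<le> (\<integral>\<^sup>+\<omega>. ennreal (f (x k \<omega>) - f_low) + ennreal ?\<beta> * ennreal (\<Phi> (err k \<omega>)) \<partial>M)"
  proof (rule nn_integral_mono)
    fix \<omega> assume \<omega>: "\<omega> \<in> space M"
    have X: "x k \<omega> \<in> X" "x (Suc k) \<omega> \<in> X" using x_in_X[OF \<omega>] kk by auto
    have "f (x (Suc k) \<omega>) + ?\<alpha> * (norm1 (x (Suc k) \<omega> - x k \<omega>))\<^sup>2 \<le> f (x k \<omega>) + ?\<beta> * (infnorm (err k \<omega>))\<^sup>2"
      using proximal_step[OF k \<omega>] L_pos \<rho> X by (intro problem.prox_step_descent) auto
    also have "\<dots> \<le> f (x k \<omega>) + ?\<beta> * \<Phi> (err k \<omega>)"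
      using \<beta> by (intro add_left_mono mult_left_mono infnorm_le_\<Phi>)
    finally have "ennreal ((f (x (Suc k) \<omega>) - f_low) + ?\<alpha> * (norm1 (x (Suc k) \<omega> - x k \<omega>))\<^sup>2)
        \<le> ennreal ((f (x k \<omega>) - f_low) + ?\<beta> * \<Phi> (err k \<omega>))"
      by (intro ennreal_leI) simp
    then show "ennreal (f (x (Suc k) \<omega>) - f_low) + ennreal ?\<alpha> * ennreal ((norm1 (x (Suc k) \<omega> - x k \<omega>))\<^sup>2)
        \<le> ennreal (f (x k \<omega>) - f_low) + ennreal ?\<beta> * ennreal (\<Phi> (err k \<omega>))"
      using \<alpha> \<beta> \<Phi>_nonneg problem.bounded_below[OF X(1)] problem.bounded_below[OF X(2)]
      by (simp only: ennreal_plus ennreal_mult diff_ge_0_iff_ge mult_nonneg_nonneg zero_le_power2)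
  qed
  also have "\<dots> = (\<integral>\<^sup>+\<omega>. ennreal (f (x k \<omega>) - f_low) \<partial>M) + ennreal ?\<beta> * (\<integral>\<^sup>+\<omega>. ennreal (\<Phi> (err k \<omega>)) \<partial>M)"
    by (subst nn_integral_add, measurable) (subst nn_integral_cmult, measurable)
  finally show ?thesis .
qed

text \<open>The integral is split by the value of \<open>Y\<close>. Each event \<open>Y = k\<close>
  is independent of the iterates, so its probability factors out for any Borel function of an
  iterate.\<close>

lemma nn_integral_output:
  assumes [measurable]: "R \<in> borel_measurable borel"
  shows "(\<integral>\<^sup>+\<omega>. R (x (Y \<omega> + 1) \<omega>) \<partial>M) = (\<Sum>k=1..K. ennreal (1 / real K) * (\<integral>\<^sup>+\<omega>. R (x (Suc k) \<omega>) \<partial>M))"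
proof -
  let ?T = "\<Pi>\<^sub>M k\<in>{1..K + 1}. borel :: (real ^ 'n) measure" and ?V = "\<lambda>\<omega>. \<lambda>k\<in>{1..K + 1}. x k \<omega>"
  have Y [measurable]: "Y \<in> measurable M (count_space UNIV)" and V [measurable]: "?V \<in> measurable M ?T"
    using index_indep by (auto simp: indep_rvs_def)
  have xm [measurable]: "x (Suc k) \<in> borel_measurable M" if "k \<in> {1..K}" for k
    using x_measurable that by simp
  have "(\<integral>\<^sup>+\<omega>. R (x (Y \<omega> + 1) \<omega>) \<partial>M)
      = (\<integral>\<^sup>+\<omega>. (\<Sum>k=1..K. indicator {k} (Y \<omega>) * R (x (Suc k) \<omega>)) \<partial>M)"
  proof (intro nn_integral_cong)
    fix \<omega> assume "\<omega> \<in> space M"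
    then have "Y \<omega> \<in> {1..K}" by (rule index_range)
    then have "R (x (Y \<omega> + 1) \<omega>) = (\<Sum>k\<in>{Y \<omega>}. indicator {k} (Y \<omega>) * R (x (Suc k) \<omega>))" by simp
    also have "\<dots> = (\<Sum>k=1..K. indicator {k} (Y \<omega>) * R (x (Suc k) \<omega>))"
      using \<open>Y \<omega> \<in> {1..K}\<close> by (intro sum.mono_neutral_left) (auto simp: indicator_def)
    finally show "R (x (Y \<omega> + 1) \<omega>) = (\<Sum>k=1..K. indicator {k} (Y \<omega>) * R (x (Suc k) \<omega>))" .
  qed
  also have "\<dots> = (\<Sum>k=1..K. (\<integral>\<^sup>+\<omega>. indicator {k} (Y \<omega>) * R (x (Suc k) \<omega>) \<partial>M))"
  proof (intro nn_integral_sum)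
    fix k assume "k \<in> {1..K}"
    then show "(\<lambda>\<omega>. indicator {k} (Y \<omega>) * R (x (Suc k) \<omega>)) \<in> borel_measurable M"
      by (intro borel_measurable_times_ennreal measurable_compose[OF Y] measurable_compose[OF xm assms]) auto
  qed
  also have "\<dots> = (\<Sum>k=1..K. ennreal (1 / real K) * (\<integral>\<^sup>+\<omega>. R (x (Suc k) \<omega>) \<partial>M))"
  proof (intro sum.cong refl)
    fix k assume k: "k \<in> {1..K}"
    then have k': "Suc k \<in> {1..K + 1}" by simp
    let ?g = "\<lambda>(y, v). indicator {k} y * R (v (Suc k)) :: ennreal"
    have Rk: "(\<lambda>v. R (v (Suc k))) \<in> borel_measurable ?T"
      by (rule measurable_compose[OF measurable_component_singleton[OF k'] assms])
    have g: "?g \<in> borel_measurable (count_space UNIV \<Otimes>\<^sub>M ?T)"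
      unfolding case_prod_beta
      by (intro borel_measurable_times_ennreal measurable_compose[OF measurable_fst]
          measurable_compose[OF measurable_snd Rk]) auto
    have "(\<integral>\<^sup>+\<omega>. indicator {k} (Y \<omega>) * R (x (Suc k) \<omega>) \<partial>M) = (\<integral>\<^sup>+\<omega>. ?g (Y \<omega>, ?V \<omega>) \<partial>M)"
      using k' by simp
    also have "\<dots> = (\<integral>\<^sup>+\<omega>. (\<integral>\<^sup>+v. ?g (Y \<omega>, v) \<partial>distr M ?T ?V) \<partial>M)"
      by (rule nn_integral_indep_rvs[OF index_indep g])
    also have "\<dots> = (\<integral>\<^sup>+\<omega>. indicator {k} (Y \<omega>) * (\<integral>\<^sup>+\<omega>. R (x (Suc k) \<omega>) \<partial>M) \<partial>M)"
    proof (intro nn_integral_cong)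
      fix \<omega>
      have "(\<integral>\<^sup>+v. ?g (Y \<omega>, v) \<partial>distr M ?T ?V) = (\<integral>\<^sup>+\<omega>'. indicator {k} (Y \<omega>) * R (?V \<omega>' (Suc k)) \<partial>M)"
        using nn_integral_distr[OF V, of "\<lambda>v. ?g (Y \<omega>, v)"] Rk by simp
      then show "(\<integral>\<^sup>+v. ?g (Y \<omega>, v) \<partial>distr M ?T ?V) = indicator {k} (Y \<omega>) * (\<integral>\<^sup>+\<omega>. R (x (Suc k) \<omega>) \<partial>M)"
        using k k' by (simp add: nn_integral_cmult)
    qed
    also have "\<dots> = (\<integral>\<^sup>+\<omega>. indicator {k} (Y \<omega>) \<partial>M) * (\<integral>\<^sup>+\<omega>. R (x (Suc k) \<omega>) \<partial>M)"
      by (intro nn_integral_multc measurable_compose[OF Y]) auto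
    also have "(\<integral>\<^sup>+\<omega>. indicator {k} (Y \<omega>) \<partial>M) = (\<integral>\<^sup>+\<omega>. indicator {\<omega> \<in> space M. Y \<omega> = k} \<omega> \<partial>M)"
      by (intro nn_integral_cong) (auto simp: indicator_def)
    also have "\<dots> = emeasure M {\<omega> \<in> space M. Y \<omega> = k}" by (intro nn_integral_indicator) measurable
    also have "\<dots> = ennreal (1 / real K)"
      using index_law[OF k] by (simp add: emeasure_eq_measure)
    finally show "(\<integral>\<^sup>+\<omega>. indicator {k} (Y \<omega>) * R (x (Suc k) \<omega>) \<partial>M)
        = ennreal (1 / real K) * (\<integral>\<^sup>+\<omega>. R (x (Suc k) \<omega>) \<partial>M)" .
  qed
  finally show ?thesis .
qed

text \<open>The inequality \<open>t \<le> t\<^sup>2 / (2 * q) + q / 2\<close> stands in for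
  Cauchy-Schwarz: the bound is linear in the second moments and can be averaged over
  \<open>k\<close> with the same weights \<open>s\<close> and \<open>r\<close>.\<close>

lemma nn_integral_residual_le:
  assumes k: "k \<in> {1..K}" and [measurable]: "R \<in> borel_measurable borel"
    and R: "\<And>v c. v \<in> X \<Longrightarrow> 0 \<le> c \<Longrightarrow>
      (\<And>y. y \<in> X \<Longrightarrow> 0 \<le> grad f v \<bullet> (y - v) + c * norm1 (y - v)) \<Longrightarrow> R v \<le> ennreal c"
    and s: "0 < s" and r: "0 < r"
  shows "(\<integral>\<^sup>+\<omega>. R (x (Suc k) \<omega>) \<partial>M)
    \<le> ennreal ((\<rho> + 2) * L / (2 * s)) * (\<integral>\<^sup>+\<omega>. ennreal ((norm1 (x (Suc k) \<omega> - x k \<omega>))\<^sup>2) \<partial>M)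
      + ennreal (1 / (2 * r)) * (\<integral>\<^sup>+\<omega>. ennreal (\<Phi> (err k \<omega>)) \<partial>M)
      + ennreal ((\<rho> + 2) * L * s / 2 + r / 2)"
proof -
  let ?A = "(\<rho> + 2) * L / (2 * s)" and ?B = "1 / (2 * r)" and ?c = "(\<rho> + 2) * L * s / 2 + r / 2"
  have pos: "0 \<le> ?A" "0 \<le> ?B" "0 \<le> ?c" using s r L_pos \<rho> by simp_all
  have kk: "k \<in> {1..Suc K}" "Suc k \<in> {1..Suc K}" using k by auto
  note [measurable] = x_measurable[OF kk(1)] x_measurable[OF kk(2)] G_measurable[OF k] problem.grad_objective_measurable
  have amgm: "t \<le> t\<^sup>2 / (2 * q) + q / 2" if "0 < q" for t q :: real
  proof -
    have "0 \<le> (t - q)\<^sup>2 / (2 * q)" using that by simp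
    also have "\<dots> = t\<^sup>2 / (2 * q) + q / 2 - t"
      using that by (simp add: power2_diff field_simps power2_eq_square)
    finally show ?thesis by simp
  qed
  have "(\<integral>\<^sup>+\<omega>. R (x (Suc k) \<omega>) \<partial>M)
    \<le> (\<integral>\<^sup>+\<omega>. ennreal ?A * ennreal ((norm1 (x (Suc k) \<omega> - x k \<omega>))\<^sup>2)
        + ennreal ?B * ennreal (\<Phi> (err k \<omega>)) + ennreal ?c \<partial>M)"
  proof (rule nn_integral_mono)
    fix \<omega> assume \<omega>: "\<omega> \<in> space M"
    let ?N = "norm1 (x (Suc k) \<omega> - x k \<omega>)" and ?e = "infnorm (err k \<omega>)"
    have X: "x k \<omega> \<in> X" "x (Suc k) \<omega> \<in> X" using x_in_X[OF \<omega>] kk by auto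
    have min: "is_arg_min (\<lambda>y. 1 / 2 * (norm (y - (x k \<omega> - (1 / L) *\<^sub>R G k \<omega>)))\<^sup>2 + \<rho> / 2 * (norm1 (y - x k \<omega>))\<^sup>2)
        (\<lambda>y. y \<in> X) (x (Suc k) \<omega>)"
      using proximal_step[OF k \<omega>] by simp
    have "R (x (Suc k) \<omega>) \<le> ennreal ((\<rho> + 2) * L * ?N + ?e)"
      using L_pos \<rho> X by (intro R problem.prox_step_stationarity[OF _ _ _ _ min]) (auto simp: infnorm_pos_le)
    also have "\<dots> \<le> ennreal (?A * ?N\<^sup>2 + ?B * \<Phi> (err k \<omega>) + ?c)"
    proof (rule ennreal_leI)
      have "(\<rho> + 2) * L * ?N \<le> (\<rho> + 2) * L * (?N\<^sup>2 / (2 * s) + s / 2)"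
        using L_pos \<rho> amgm[OF s] by (intro mult_left_mono) auto
      moreover have "?e \<le> \<Phi> (err k \<omega>) / (2 * r) + r / 2"
        using amgm[OF r, of ?e] divide_right_mono[OF infnorm_le_\<Phi>[of "err k \<omega>"], of "2 * r"] r by simp
      ultimately show "(\<rho> + 2) * L * ?N + ?e \<le> ?A * ?N\<^sup>2 + ?B * \<Phi> (err k \<omega>) + ?c"
        by (simp add: distrib_left)
    qed
    also have "\<dots> = ennreal ?A * ennreal (?N\<^sup>2) + ennreal ?B * ennreal (\<Phi> (err k \<omega>)) + ennreal ?c"
      using pos \<Phi>_nonneg by (simp only: ennreal_plus ennreal_mult add_nonneg_nonneg mult_nonneg_nonneg zero_le_power2)
    finally show "R (x (Suc k) \<omega>)
        \<le> ennreal ?A * ennreal (?N\<^sup>2) + ennreal ?B * ennreal (\<Phi> (err k \<omega>)) + ennreal ?c" .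
  qed
  also have "\<dots> = ennreal ?A * (\<integral>\<^sup>+\<omega>. ennreal ((norm1 (x (Suc k) \<omega> - x k \<omega>))\<^sup>2) \<partial>M)
      + ennreal ?B * (\<integral>\<^sup>+\<omega>. ennreal (\<Phi> (err k \<omega>)) \<partial>M) + ennreal ?c"
    by (subst nn_integral_add, measurable, subst nn_integral_add, measurable, subst nn_integral_cmult, measurable,
        subst nn_integral_cmult, measurable, simp add: emeasure_space_1)
  finally show ?thesis .
qed

lemma expected_stationarity:
  assumes \<rho>6: "6 \<le> \<rho>" and \<epsilon>: "0 < \<epsilon>"
    and int: "integrable M (\<lambda>\<omega>. f (x 1 \<omega>))" and \<Delta>: "\<Delta> = (\<integral>\<omega>. f (x 1 \<omega>) \<partial>M) - f_low"
    and K: "\<Delta> * L / \<epsilon>\<^sup>2 \<le> real K"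
    and m1: "C * (sigma_inf D F X)\<^sup>2 / real m1 \<le> \<epsilon>\<^sup>2"
    and m: "C * real q0 / real m \<le> 1"
  shows "(\<integral>\<^sup>+\<omega>. dist_inf_zero
        (frechet_subdiff (\<lambda>y. ereal (f y) + indicator_fun X y) (x (Y \<omega> + 1) \<omega>)) \<partial>M)
       \<le> ennreal (C3 \<rho> * \<epsilon>)"
proof -
  define \<alpha> where "\<alpha> = (\<rho> / 4 - 1 / 2) * L"
  define \<beta> where "\<beta> = 1 / (\<rho> * L)"
  define c where "c = 4 * C * L\<^sup>2 / real m"
  define Fs where "Fs k = (\<integral>\<^sup>+\<omega>. ennreal (f (x k \<omega>) - f_low) \<partial>M)" for k
  define Es where "Es k = (\<integral>\<^sup>+\<omega>. ennreal (\<Phi> (err k \<omega>)) \<partial>M)" for k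
  define Ds where "Ds k = (\<integral>\<^sup>+\<omega>. ennreal ((norm1 (x (Suc k) \<omega> - x k \<omega>))\<^sup>2) \<partial>M)" for k
  note L = L_pos
  have pos: "0 < \<alpha>" "0 \<le> \<beta>" "0 \<le> c" "0 \<le> \<epsilon>\<^sup>2"
    using L \<rho>6 C by (simp_all add: \<alpha>_def \<beta>_def c_def)
  have K1: "1 \<le> K" and q0: "1 \<le> q0" using counts_pos by auto
  have nonneg: "0 \<le> f (x 1 \<omega>) - f_low" if "\<omega> \<in> space M" for \<omega>
    using problem.bounded_below[OF x_in_X[OF that, of 1]] K1 by simp
  have int': "integrable M (\<lambda>\<omega>. f (x 1 \<omega>) - f_low)" using int by simp
  have \<Delta>': "(\<integral>\<omega>. f (x 1 \<omega>) - f_low \<partial>M) = \<Delta>"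
    using int by (simp add: \<Delta> prob_space)
  then have \<Delta>0: "0 \<le> \<Delta>"
    using integral_nonneg_AE[of "\<lambda>\<omega>. f (x 1 \<omega>) - f_low" M] nonneg by auto
  have F1: "Fs 1 = ennreal \<Delta>"
    unfolding Fs_def using nn_integral_eq_integral[OF int'] nonneg \<Delta>' by auto
  obtain d e where d: "\<And>k. 0 \<le> d k" and e: "\<And>k. 0 \<le> e k"
    and Ds: "\<And>k. k \<in> {1..K} \<Longrightarrow> Ds k = ennreal (d k)" and Es: "\<And>k. k \<in> {1..K} \<Longrightarrow> Es k = ennreal (e k)"
    and Se: "(\<Sum>k=1..K. e k) \<le> real K * \<epsilon>\<^sup>2 + real q0 * c * (\<Sum>k=1..K. d k)"
    and Sd: "\<alpha> * (\<Sum>k=1..K. d k) \<le> \<Delta> + \<beta> * (\<Sum>k=1..K. e k)"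
  proof (rule ennreal_recursion_real[of q0 K \<alpha> \<beta> c "\<epsilon>\<^sup>2" \<Delta> Fs Ds Es])
    show "Fs (Suc k) + ennreal \<alpha> * Ds k \<le> Fs k + ennreal \<beta> * Es k" if "k \<in> {1..K}" for k
      using objective_descent[OF that] by (simp only: Fs_def Ds_def Es_def \<alpha>_def \<beta>_def)
    show "Es k \<le> ennreal (\<epsilon>\<^sup>2)" if "k \<in> {1..K}" "restart q0 k" for k
      unfolding Es_def using err_potential_restart[OF that] ennreal_leI[OF m1] by (rule order.trans)
    show "Es k \<le> Es (k - 1) + ennreal c * Ds (k - 1)" if "k \<in> {1..K}" "\<not> restart q0 k" for k
      using err_potential_step[OF that] that by (simp add: Es_def Ds_def c_def)
  qed (use q0 K1 pos \<Delta>0 F1 in auto)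
  define S where "S = (\<Sum>k=1..K. d k)"
  define T where "T = (\<Sum>k=1..K. e k)"
  \<comment> \<open>The descent coefficient, in units of \<open>L\<close>, after subtracting what
    the accumulated errors give back; positive for \<open>\<rho> \<ge> 6\<close>.\<close>
  define a where "a = \<rho> / 4 - 1 / 2 - 4 / \<rho>"
  define u where "u = (1 + 1 / \<rho>) / a"
  have S: "0 \<le> S" unfolding S_def using d by (intro sum_nonneg)
  have "36 \<le> \<rho> * \<rho>" using mult_mono[OF \<rho>6 \<rho>6] \<rho>6 by simp
  moreover have "6 * \<rho> \<le> \<rho> * \<rho>" using \<rho>6 by (intro mult_right_mono) auto
  ultimately have P: "0 < \<rho>\<^sup>2 - 2 * \<rho> - 16"
    using \<rho>6 unfolding power2_eq_square by linarith
  have a_eq: "a = (\<rho>\<^sup>2 - 2 * \<rho> - 16) / (4 * \<rho>)"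
    using \<rho>6 by (simp add: a_def field_simps power2_eq_square)
  then have a: "0 < a" using P \<rho>6 by simp
  have u: "0 < u" using a \<rho>6 by (simp add: u_def add_pos_pos)
  have u_eq: "u = 4 * ((\<rho> + 1) / (\<rho>\<^sup>2 - 2 * \<rho> - 16))"
  proof -
    have "1 + 1 / \<rho> = (\<rho> + 1) / \<rho>" using \<rho>6 by (simp add: field_simps)
    then show ?thesis unfolding u_def a_eq using \<rho>6 by simp
  qed
  \<comment> \<open>The lower bound on \<open>m\<close> cancels the constant \<open>C\<close> of the
    potential; nothing after this depends on the dimension.\<close>
  have "real q0 * c = 4 * L\<^sup>2 * (C * real q0 / real m)" by (simp add: c_def)
  also have "\<dots> \<le> 4 * L\<^sup>2 * 1" using m by (intro mult_left_mono) auto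
  finally have "real q0 * c * S \<le> 4 * L\<^sup>2 * S" using S by (intro mult_right_mono) auto
  with Se have T: "T \<le> real K * \<epsilon>\<^sup>2 + 4 * L\<^sup>2 * S" unfolding S_def T_def by linarith
  have \<Delta>K: "\<Delta> \<le> real K * \<epsilon>\<^sup>2 / L"
    using K \<epsilon> L by (simp add: field_simps)
  have "\<alpha> * S \<le> \<Delta> + \<beta> * T" using Sd by (simp add: S_def T_def)
  also have "\<dots> \<le> real K * \<epsilon>\<^sup>2 / L + \<beta> * (real K * \<epsilon>\<^sup>2 + 4 * L\<^sup>2 * S)"
    using \<Delta>K T pos by (intro add_mono mult_left_mono) auto
  also have "\<dots> = real K * \<epsilon>\<^sup>2 / L * (1 + 1 / \<rho>) + 4 / \<rho> * L * S"
    using L \<rho>6 by (simp add: \<beta>_def field_simps power2_eq_square)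
  finally have "L * a * S \<le> real K * \<epsilon>\<^sup>2 / L * (1 + 1 / \<rho>)"
    by (simp add: \<alpha>_def a_def algebra_simps)
  then have "S \<le> (real K * \<epsilon>\<^sup>2 / L * (1 + 1 / \<rho>)) / (L * a)"
    using L a by (subst pos_le_divide_eq) (simp_all add: mult.commute)
  also have "\<dots> = real K * (u * \<epsilon>\<^sup>2 / L\<^sup>2)"
    by (simp add: u_def power2_eq_square mult_ac)
  finally have S_le: "S \<le> real K * (u * \<epsilon>\<^sup>2 / L\<^sup>2)" .
  have "4 * L\<^sup>2 * S \<le> 4 * L\<^sup>2 * (real K * (u * \<epsilon>\<^sup>2 / L\<^sup>2))"
    using S_le by (intro mult_left_mono) auto
  also have "\<dots> = real K * (4 * u * \<epsilon>\<^sup>2)" using L by simp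
  finally have T_le: "T \<le> real K * ((1 + 4 * u) * \<epsilon>\<^sup>2)"
    using T by (simp add: algebra_simps)
  \<comment> \<open>\<open>s\<close> and \<open>r\<close> are the root mean square bounds on step
    length and error just obtained; with these weights the result is the same as by
    Cauchy-Schwarz.\<close>
  define s where "s = sqrt u * \<epsilon> / L"
  define r where "r = sqrt (1 + 4 * u) * \<epsilon>"
  have s: "0 < s" and r: "0 < r" using u \<epsilon> L by (simp_all add: s_def r_def)
  have s2: "s\<^sup>2 = u * \<epsilon>\<^sup>2 / L\<^sup>2" and r2: "r\<^sup>2 = (1 + 4 * u) * \<epsilon>\<^sup>2"
    using u by (simp_all add: s_def r_def power_mult_distrib power_divide)
  obtain R where R [measurable]: "R \<in> borel_measurable borel"
    and R1: "\<forall>v\<in>X. dist_inf_zero (frechet_subdiff (\<lambda>y. ereal (f y) + indicator_fun X y) v) \<le> R v"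
    and R2: "\<forall>v\<in>X. \<forall>c\<ge>0. (\<forall>y\<in>X. 0 \<le> grad f v \<bullet> (y - v) + c * norm1 (y - v)) \<longrightarrow> R v \<le> ennreal c"
    using measurable_residual_exists[OF problem.objective_differentiable problem.convex_X] by (elim bexE conjE)
  let ?A = "(\<rho> + 2) * L / (2 * s)" and ?B = "1 / (2 * r)" and ?c = "(\<rho> + 2) * L * s / 2 + r / 2"
  have pos': "0 \<le> ?A" "0 \<le> ?B" "0 \<le> ?c" using s r L \<rho>6 by simp_all
  have summand_nonneg: "0 \<le> ?A * d k + ?B * e k + ?c" for k
    by (intro pos' d e add_nonneg_nonneg mult_nonneg_nonneg)
  have "(\<integral>\<^sup>+\<omega>. dist_inf_zero
        (frechet_subdiff (\<lambda>y. ereal (f y) + indicator_fun X y) (x (Y \<omega> + 1) \<omega>)) \<partial>M)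
      \<le> (\<integral>\<^sup>+\<omega>. R (x (Y \<omega> + 1) \<omega>) \<partial>M)"
    using index_range by (intro nn_integral_mono R1[rule_format] x_in_X) auto
  also have "\<dots> = (\<Sum>k=1..K. ennreal (1 / real K) * (\<integral>\<^sup>+\<omega>. R (x (Suc k) \<omega>) \<partial>M))"
    by (rule nn_integral_output[OF R])
  also have "\<dots> \<le> (\<Sum>k=1..K. ennreal (1 / real K * (?A * d k + ?B * e k + ?c)))"
  proof (intro sum_mono)
    fix k assume k: "k \<in> {1..K}"
    have "(\<integral>\<^sup>+\<omega>. R (x (Suc k) \<omega>) \<partial>M) \<le> ennreal ?A * Ds k + ennreal ?B * Es k + ennreal ?c"
      unfolding Ds_def Es_def using R2 by (intro nn_integral_residual_le[OF k R _ s r]) simp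
    also have "\<dots> = ennreal (?A * d k + ?B * e k + ?c)"
      using pos' d e by (simp only: Ds[OF k] Es[OF k] ennreal_plus ennreal_mult add_nonneg_nonneg mult_nonneg_nonneg)
    finally have "ennreal (1 / real K) * (\<integral>\<^sup>+\<omega>. R (x (Suc k) \<omega>) \<partial>M)
        \<le> ennreal (1 / real K) * ennreal (?A * d k + ?B * e k + ?c)"
      by (intro mult_left_mono) auto
    also have "\<dots> = ennreal (1 / real K * (?A * d k + ?B * e k + ?c))"
      by (intro ennreal_mult[symmetric] summand_nonneg) simp
    finally show "ennreal (1 / real K) * (\<integral>\<^sup>+\<omega>. R (x (Suc k) \<omega>) \<partial>M)
        \<le> ennreal (1 / real K * (?A * d k + ?B * e k + ?c))" .
  qed
  also have "\<dots> = ennreal (\<Sum>k=1..K. 1 / real K * (?A * d k + ?B * e k + ?c))"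
    by (intro sum_ennreal mult_nonneg_nonneg summand_nonneg) simp
  also have "\<dots> \<le> ennreal (C3 \<rho> * \<epsilon>)"
  proof (rule ennreal_leI)
    have "(\<Sum>k=1..K. 1 / real K * (?A * d k + ?B * e k + ?c)) = 1 / real K * (?A * S + ?B * T + real K * ?c)"
      unfolding S_def T_def by (simp only: sum_distrib_left[symmetric] sum.distrib) (simp add: distrib_left)
    also have "\<dots> \<le> 1 / real K * (?A * (real K * s\<^sup>2) + ?B * (real K * r\<^sup>2) + real K * ?c)"
      using S_le T_le pos' unfolding s2 r2 by (intro mult_left_mono add_mono) auto
    also have "\<dots> = (\<rho> + 2) * L * s + r"
      using K1 s r by (simp add: field_simps power2_eq_square)
    also have "\<dots> = ((\<rho> + 2) * sqrt u + sqrt (1 + 4 * u)) * \<epsilon>"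
      using L by (simp add: s_def r_def algebra_simps)
    also have "sqrt (1 + 4 * u) \<le> 1 + 2 * sqrt u"
    proof (rule real_le_lsqrt)
      show "1 + 4 * u \<le> (1 + 2 * sqrt u)\<^sup>2"
        using u by (simp add: power2_sum power_mult_distrib)
    qed (use u in auto)
    then have "((\<rho> + 2) * sqrt u + sqrt (1 + 4 * u)) * \<epsilon> \<le> ((\<rho> + 2) * sqrt u + (1 + 2 * sqrt u)) * \<epsilon>"
      using \<epsilon> by (intro mult_right_mono add_left_mono) auto
    also have "\<dots> = (1 + (\<rho> + 4) * sqrt u) * \<epsilon>" by (simp add: algebra_simps)
    also have "sqrt u = 2 * sqrt ((\<rho> + 1) / (\<rho>\<^sup>2 - 2 * \<rho> - 16))"
      unfolding u_eq by (simp only: real_sqrt_mult real_sqrt_four)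
    also have "(1 + (\<rho> + 4) * (2 * sqrt ((\<rho> + 1) / (\<rho>\<^sup>2 - 2 * \<rho> - 16)))) * \<epsilon> = C3 \<rho> * \<epsilon>"
      by (simp add: C3_def)
    finally show "(\<Sum>k=1..K. 1 / real K * (?A * d k + ?B * e k + ?c)) \<le> C3 \<rho> * \<epsilon>" .
  qed
  finally show ?thesis .
qed

end

section \<open>Sample counts and the final assembly\<close>

lemma complexity_bounds:
  fixes \<Delta> L \<epsilon> \<sigma> \<Omega> :: real and q0 m1 m K :: nat
  assumes pos: "1 \<le> q0" "0 < \<epsilon>" and \<Omega>: "2 \<le> \<Omega>"
    and K: "K = nat \<lceil>\<Delta> * L / \<epsilon>\<^sup>2\<rceil>"
    and m1: "m1 = nat \<lceil>\<Omega>\<^sup>2 * \<sigma>\<^sup>2 / \<epsilon>\<^sup>2\<rceil>"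
    and m: "m = nat \<lceil>real q0 * \<Omega>\<^sup>2\<rceil>" and m_q0: "m * q0 = m1"
    and \<epsilon>: "\<epsilon> \<le> min \<sigma> (\<Delta> * L / \<sigma>)"
  shows "K * m + nat \<lceil>real K / real q0\<rceil> * m1 \<le> 3 * K * m"
    and "real (3 * K * m) \<le> 18 * (\<Delta> * L * \<Omega>\<^sup>2 * \<sigma> / \<epsilon> ^ 3)"
proof -
  \<comment> \<open>The natural size of \<open>q0\<close>: up to rounding,
    \<open>m * q0 = m1\<close> reads \<open>q0\<^sup>2 * \<Omega>\<^sup>2 = \<Omega>\<^sup>2 *
    \<tau>\<^sup>2\<close>.\<close>
  define \<tau> where "\<tau> = \<sigma> / \<epsilon>"
  have \<sigma>: "\<epsilon> \<le> \<sigma>" "\<epsilon> \<le> \<Delta> * L / \<sigma>" using \<epsilon> by auto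
  then have \<sigma>0: "0 < \<sigma>" using pos by simp
  have \<tau>1: "1 \<le> \<tau>" using \<sigma> pos by (simp add: \<tau>_def)
  have \<Delta>L: "\<epsilon> * \<sigma> \<le> \<Delta> * L" using \<sigma>(2) \<sigma>0 by (simp add: pos_le_divide_eq)
  have "\<tau> = \<epsilon> * \<sigma> / \<epsilon>\<^sup>2" using pos by (simp add: \<tau>_def power2_eq_square)
  also have "\<dots> \<le> \<Delta> * L / \<epsilon>\<^sup>2" using \<Delta>L by (intro divide_right_mono) auto
  finally have \<tau>K: "\<tau> \<le> \<Delta> * L / \<epsilon>\<^sup>2" .
  have K_ge: "\<tau> \<le> real K" using \<tau>K unfolding K by linarith
  define v where "v = \<Delta> * L / \<epsilon>\<^sup>2"
  have "1 \<le> v" using \<tau>K \<tau>1 by (simp add: v_def)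
  then have "real (nat \<lceil>v\<rceil>) \<le> 2 * v" by linarith
  then have K_le: "real K \<le> 2 * (\<Delta> * L / \<epsilon>\<^sup>2)" by (simp only: K v_def)
  have \<Omega>4: "4 \<le> \<Omega>\<^sup>2" using power_mono[OF \<Omega>, of 2] by simp
  have m1_le: "real m1 \<le> \<Omega>\<^sup>2 * \<tau>\<^sup>2 + 1"
  proof -
    have "0 \<le> \<Omega>\<^sup>2 * \<sigma>\<^sup>2 / \<epsilon>\<^sup>2" by simp
    then have "real m1 \<le> \<Omega>\<^sup>2 * \<sigma>\<^sup>2 / \<epsilon>\<^sup>2 + 1" unfolding m1 by linarith
    then show ?thesis by (simp add: \<tau>_def power_divide)
  qed
  have m_ge: "real q0 * \<Omega>\<^sup>2 \<le> real m" unfolding m by linarith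
  have "0 \<le> real q0 * \<Omega>\<^sup>2" by simp
  then have m_le: "real m \<le> real q0 * \<Omega>\<^sup>2 + 1" unfolding m by linarith
  have "(real q0)\<^sup>2 * \<Omega>\<^sup>2 \<le> real m * real q0"
    using mult_right_mono[OF m_ge, of "real q0"] by (simp add: power2_eq_square mult_ac)
  also have "\<dots> = real m1" using m_q0 by (metis of_nat_mult)
  also have "\<dots> \<le> \<Omega>\<^sup>2 * \<tau>\<^sup>2 + 1" by (rule m1_le)
  also have "\<dots> \<le> \<Omega>\<^sup>2 * \<tau>\<^sup>2 + \<Omega>\<^sup>2 * (1 / 4)" using \<Omega>4 by simp
  finally have "(real q0)\<^sup>2 * \<Omega>\<^sup>2 \<le> (\<tau>\<^sup>2 + 1 / 4) * \<Omega>\<^sup>2" by (simp add: algebra_simps)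
  then have q0_sq: "(real q0)\<^sup>2 \<le> \<tau>\<^sup>2 + 1 / 4" using \<Omega> by (simp add: mult_le_cancel_right)
  \<comment> \<open>The interval fits into the run since \<open>\<tau> \<le> K\<close>. The
    \<open>1 / 4\<close> left by rounding \<open>m1\<close> disappears because both squares are
    integers.\<close>
  have "q0 \<le> K"
  proof -
    have "\<tau>\<^sup>2 \<le> (real K)\<^sup>2" using K_ge \<tau>1 by (intro power_mono) auto
    then have "(real q0)\<^sup>2 < (real K)\<^sup>2 + 1" using q0_sq by linarith
    then have "real (q0\<^sup>2) < real (K\<^sup>2 + 1)" by simp
    then have "q0\<^sup>2 \<le> K\<^sup>2" by (simp only: of_nat_less_iff less_Suc_eq_le[symmetric] Suc_eq_plus1)
    then show ?thesis by (rule power2_le_imp_le[of q0]) simp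
  qed
  show "K * m + nat \<lceil>real K / real q0\<rceil> * m1 \<le> 3 * K * m"
  proof -
    have "real (nat \<lceil>real K / real q0\<rceil>) \<le> real K / real q0 + 1"
      by (rule order.trans[OF _ of_int_ceiling_le_add_one]) simp
    then have "real (nat \<lceil>real K / real q0\<rceil>) * real q0 \<le> (real K / real q0 + 1) * real q0"
      by (intro mult_right_mono) auto
    also have "\<dots> = real K + real q0" using pos by (simp add: field_simps)
    finally have "real (nat \<lceil>real K / real q0\<rceil> * q0) \<le> real (2 * K)" using \<open>q0 \<le> K\<close> by simp
    then have "nat \<lceil>real K / real q0\<rceil> * q0 \<le> 2 * K" by (simp only: of_nat_le_iff)
    then have "nat \<lceil>real K / real q0\<rceil> * q0 * m \<le> 2 * K * m" by (rule mult_le_mono1)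
    moreover have "nat \<lceil>real K / real q0\<rceil> * m1 = nat \<lceil>real K / real q0\<rceil> * q0 * m"
      unfolding m_q0[symmetric] by (simp only: mult_ac)
    ultimately show ?thesis by linarith
  qed
  have "(real q0)\<^sup>2 \<le> (2 * \<tau>)\<^sup>2"
    using q0_sq one_le_power[OF \<tau>1, of 2] by (simp add: power_mult_distrib)
  then have q0_le: "real q0 \<le> 2 * \<tau>" using \<tau>1 by (intro power2_le_imp_le[of "real q0"]) auto
  have "1 \<le> \<tau> * \<Omega>\<^sup>2" using mult_mono[OF \<tau>1, of 1 "\<Omega>\<^sup>2"] \<Omega>4 \<tau>1 by simp
  \<comment> \<open>Two units come from \<open>q0 \<le> 2 * \<tau>\<close> and one from rounding;
    with \<open>K \<le> 2 * (\<Delta> * L / \<epsilon>\<^sup>2)\<close> the constant is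
    \<open>3 * 2 * 3 = 18\<close>.\<close>
  then have m_le': "real m \<le> 3 * (\<tau> * \<Omega>\<^sup>2)"
    using m_le mult_right_mono[OF q0_le, of "\<Omega>\<^sup>2"] by simp
  have "real (3 * K * m) \<le> 3 * (2 * (\<Delta> * L / \<epsilon>\<^sup>2)) * (3 * (\<tau> * \<Omega>\<^sup>2))"
    using mult_mono[OF K_le m_le'] \<tau>K \<tau>1 by simp
  also have "\<dots> = 18 * (\<Delta> * L * \<Omega>\<^sup>2 * \<sigma> / \<epsilon> ^ 3)"
    using pos by (simp add: \<tau>_def power2_eq_square power3_eq_cube)
  finally show "real (3 * K * m) \<le> 18 * (\<Delta> * L * \<Omega>\<^sup>2 * \<sigma> / \<epsilon> ^ 3)" .
qed

text \<open>Explicit constants stand for the O-notation, so no dependence on dimension or data can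
  hide in them. The condition on \<open>\<epsilon>\<close> describes the small-accuracy regime: it
  gives \<open>1 \<le> \<sigma> / \<epsilon> \<le> K\<close>, so that rounding costs constant
  factors only and an interval fits into the run.\<close>

theorem corollary3:
  fixes D :: "'z measure"
    and M :: "'w measure"
    and F :: "real ^ 'n \<Rightarrow> 'z \<Rightarrow> real"
    and X :: "(real ^ 'n) set"
    and x G :: "nat \<Rightarrow> 'w \<Rightarrow> real ^ 'n"
    and \<zeta> :: "nat \<Rightarrow> nat \<Rightarrow> 'w \<Rightarrow> 'z"
    and Y :: "'w \<Rightarrow> nat"
    and L f_low \<eta> \<rho> \<epsilon> \<sigma> \<Delta> \<Omega> t d :: real
    and q0 m1 m K :: nat
  assumes problem: "stochastic_problem D F X L f_low"
    and run: "variance_reduced_method M D F X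
      (\<lambda>z. \<rho> / 2 * (norm1 z)\<^sup>2) (\<lambda>_. \<eta>) (\<lambda>_. 1 / real K) q0 m1 m K x G \<zeta> Y"
    and start_integrable: "integrable M (\<lambda>\<omega>. objective D F (x 1 \<omega>))"
    and Delta: "\<Delta> = (\<integral>\<omega>. objective D F (x 1 \<omega>) \<partial>M) - f_low"
    and d: "d = real CARD('n)"
    and sigma: "\<sigma> = sigma_inf D F X"
    and eps: "\<epsilon> > 0"
    and Omega: "\<Omega> = exp 2 * ln d"
    and t: "t = 2 * \<eta> / \<rho>"
    and parameter_condition:
      "\<rho> / (4 * \<eta>) - L / 2 - 2 * t * \<Omega>\<^sup>2 * L\<^sup>2 * real q0 / real m > 0"
    and eta: "\<eta> = 1 / L"
    and K: "K = nat \<lceil>\<Delta> * L / \<epsilon>\<^sup>2\<rceil>"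
    and m1: "m1 = nat \<lceil>\<Omega> * exp 2 * ln d * \<sigma>\<^sup>2 / \<epsilon>\<^sup>2\<rceil>"
    and m: "m = nat \<lceil>real q0 * \<Omega>\<^sup>2\<rceil>"
    and m_q0: "m * q0 = m1"
    and rho: "\<rho> \<ge> 6"
  shows
    "(\<integral>\<^sup>+\<omega>. dist_inf_zero
        (frechet_subdiff (\<lambda>y. ereal (objective D F y) + indicator_fun X y) (x (Y \<omega> + 1) \<omega>)) \<partial>M)
       \<le> ennreal (C3 \<rho> * \<epsilon>)
     \<and> sample_complexity q0 m1 m K \<le> K * m + nat \<lceil>real K / real q0\<rceil> * m1
     \<and> (\<epsilon> \<le> min \<sigma> (\<Delta> * L / \<sigma>) \<longrightarrow>
          K * m + nat \<lceil>real K / real q0\<rceil> * m1 \<le> 3 * K * m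
          \<and> real (3 * K * m) \<le> 18 * (\<Delta> * L * \<Omega>\<^sup>2 * \<sigma> / \<epsilon> ^ 3)
          \<and> real (3 * K * m) \<le> 18 * exp 4 * (\<Delta> * L * (ln d)\<^sup>2 * \<sigma> / \<epsilon> ^ 3))"
proof -
  interpret run: variance_reduced_method M D F X "\<lambda>z. \<rho> / 2 * (norm1 z)\<^sup>2" "\<lambda>_. 1 / L" "\<lambda>_. 1 / real K"
      q0 m1 m K x G \<zeta> Y
    using run unfolding eta .
  have m_pos: "1 \<le> m" and m1_pos: "1 \<le> m1" and q0: "1 \<le> q0" using run.counts_pos by auto
  \<comment> \<open>In dimension one \<open>\<Omega> = 0\<close> would give \<open>m = 0\<close>,
    against the positive batch size.\<close>
  have d2: "CARD('n) \<ge> 2"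
  proof (rule ccontr)
    assume "\<not> CARD('n) \<ge> 2"
    moreover have "CARD('n) \<noteq> 0" by simp
    ultimately have "CARD('n) = 1" by linarith
    then have "m = 0" by (simp add: m Omega d)
    then show False using m_pos by simp
  qed
  have "ln 2 \<le> ln d" using d2 by (simp add: d)
  then have "2 / 3 \<le> ln d" using ln2_ge_two_thirds by linarith
  moreover have "3 \<le> exp (2::real)" using exp_ge_add_one_self[of 2] by simp
  ultimately have Omega2: "2 \<le> \<Omega>" using mult_mono[of 3 "exp 2" "2 / 3" "ln d"] by (simp add: Omega)
  have m1': "m1 = nat \<lceil>\<Omega>\<^sup>2 * \<sigma>\<^sup>2 / \<epsilon>\<^sup>2\<rceil>" unfolding m1 by (simp add: Omega power2_eq_square mult_ac)
  obtain \<Phi> :: "real ^ 'n \<Rightarrow> real" where \<Phi>: "\<Phi> \<in> borel_measurable borel" "\<Phi> 0 = 0" "\<And>v. (infnorm v)\<^sup>2 \<le> \<Phi> v"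
    "\<And>a. \<exists>g. \<forall>y. \<Phi> (a + y) \<le> \<Phi> a + g \<bullet> y + \<Omega>\<^sup>2 * (infnorm y)\<^sup>2"
    using smooth_potential_exists[OF d2] unfolding Omega d by blast
  interpret vr_run D M F X L f_low \<rho> q0 m1 m K x G \<zeta> Y \<Phi> "\<Omega>\<^sup>2"
    by (intro vr_run.intro problem run.variance_reduced_method_axioms vr_run_axioms.intro \<Phi>) (use rho in auto)
  have "\<Delta> * L / \<epsilon>\<^sup>2 \<le> real K" unfolding K by linarith
  moreover have "\<Omega>\<^sup>2 * (sigma_inf D F X)\<^sup>2 / real m1 \<le> \<epsilon>\<^sup>2"
  proof -
    have "\<Omega>\<^sup>2 * \<sigma>\<^sup>2 / \<epsilon>\<^sup>2 \<le> real m1" unfolding m1' by linarith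
    then have "\<Omega>\<^sup>2 * \<sigma>\<^sup>2 \<le> real m1 * \<epsilon>\<^sup>2" using eps by (simp add: pos_divide_le_eq)
    then show ?thesis using m1_pos by (simp add: pos_divide_le_eq sigma mult.commute)
  qed
  moreover have "\<Omega>\<^sup>2 * real q0 / real m \<le> 1"
  proof -
    have "real q0 * \<Omega>\<^sup>2 \<le> real m" unfolding m by linarith
    then show ?thesis using m_pos by (simp add: pos_divide_le_eq mult.commute)
  qed
  ultimately have 1: "(\<integral>\<^sup>+\<omega>. dist_inf_zero
        (frechet_subdiff (\<lambda>y. ereal (objective D F y) + indicator_fun X y) (x (Y \<omega> + 1) \<omega>)) \<partial>M)
       \<le> ennreal (C3 \<rho> * \<epsilon>)"
    by (intro expected_stationarity[OF rho eps start_integrable Delta])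
  have \<Omega>_sq: "\<Omega>\<^sup>2 = exp 4 * (ln d)\<^sup>2"
    by (simp add: Omega power_mult_distrib flip: exp_double)
  have "real (3 * K * m) \<le> 18 * exp 4 * (\<Delta> * L * (ln d)\<^sup>2 * \<sigma> / \<epsilon> ^ 3)"
    if "real (3 * K * m) \<le> 18 * (\<Delta> * L * \<Omega>\<^sup>2 * \<sigma> / \<epsilon> ^ 3)"
    using that unfolding \<Omega>_sq by (simp add: mult_ac)
  with 1 sample_complexity_le[OF q0] complexity_bounds[OF q0 eps Omega2 K m1' m m_q0]
  show ?thesis by blast
qed

end
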